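(* Let $c(N,d)$ denote the number of classes $C\subseteq\{\pm1\}^N$ with VC dimension $d$. For every $d>0$ there is $N_0=N_0(d)$ such that for all $N>N_0$, $$N^{(\Omega(N/d))^d}\leq c(N,d)\leq N^{(O(N))^d}.$$
   Context: The VC dimension of a class $C\subseteq\{\pm1\}^N$ is the maximum size of a set of coordinates $Y\subseteq[N]$ such that every pattern in $\{\pm1\}^Y$ is the restriction of some member of $C$ to $Y$. *)

theory Defs
  imports Complex_Main "HOL-Library.FuncSet"
begin

definition sign_cube :: "nat set \<Rightarrow> (nat \<Rightarrow> int) set" where
  "sign_cube Y = Y \<rightarrow>\<^sub>E {-1, 1}"

definition shatters :: "(nat \<Rightarrow> int) set \<Rightarrow> nat set \<Rightarrow> bool" where
  "shatters C Y \<longleftrightarrow> (\<forall>p \<in> sign_cube Y. \<exists>f\<in>C. restrict f Y = p)"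

text \<open>The empty class shatters no set, not even the empty one; since the supremum of the
  empty set of natural numbers is 0, it gets VC dimension 0 here. For a nonempty class the
  supremum is a maximum over a finite nonempty set.\<close>

definition vc_dim :: "nat \<Rightarrow> (nat \<Rightarrow> int) set \<Rightarrow> nat" where
  "vc_dim N C = Sup {card Y | Y. Y \<subseteq> {1..N} \<and> shatters C Y}"

definition num_classes :: "nat \<Rightarrow> nat \<Rightarrow> nat" where
  "num_classes N d = card {C. C \<subseteq> sign_cube {1..N} \<and> vc_dim N C = d}"

end

theory Submission
  imports Defs
begin

text \<open>
  Classes are identified with set families over \<open>S = {1..N}\<close>.

  Upper bound: every family of VC dimension at most \<open>d\<close> lies in a connected subset of the cube
  with \<open>(O(N))\<^sup>d\<close> vertices, and there are at most \<open>N\<close> to the power \<open>(O(N))\<^sup>d\<close> pairs of such a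
  connected set and a subfamily of it. For \<open>d \<ge> 2\<close> the connected set is built with Haussler's packing
  bound: a family of size \<open>M\<close> has two members at distance \<open>O(d + d N / M\<^bsup>1/d\<^esup>)\<close>; remove one of them,
  connect the rest, and join the removed member by a shortest path. The distances sum up to
  \<open>(O(N))\<^sup>d\<close> exactly because \<open>1/d < 1\<close>.

  Lower bound: split \<open>S\<close> into halves \<open>P\<close> and \<open>Q\<close> and attach to each \<open>d\<close>-subset \<open>X\<close> of \<open>P\<close> an
  arbitrary point \<open>h X\<close> of \<open>Q\<close>. The sets \<open>X \<union> {h X}\<close> shatter no \<open>(d + 1)\<close>-set, since such a set would
  be one of them, and then its trace \<open>X\<close> is missing. Adding the power set of a \<open>d\<close>-subset of \<open>Q\<close>
  makes the dimension exactly \<open>d\<close>.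
\<close>

section \<open>Shattering and one-inclusion edges\<close>

definition set_shatters :: "'a set set \<Rightarrow> 'a set \<Rightarrow> bool" where
  "set_shatters F Y \<longleftrightarrow> (\<forall>B\<subseteq>Y. \<exists>A\<in>F. A \<inter> Y = B)"

text \<open>\<open>Y\<close> ranges over all finite sets, so no ground set has to be carried along;
  if \<open>F \<subseteq> Pow S\<close>, shattered sets lie in \<open>S\<close> anyway. The empty
  family satisfies this for every \<open>d\<close>.\<close>

definition vc_le :: "nat \<Rightarrow> 'a set set \<Rightarrow> bool" where
  "vc_le d F \<longleftrightarrow> (\<forall>Y. finite Y \<longrightarrow> set_shatters F Y \<longrightarrow> card Y \<le> d)"

definition trace :: "'a set set \<Rightarrow> 'a set \<Rightarrow> 'a set set" where
  "trace F S = (\<lambda>A. A \<inter> S) ` F"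

definition doubled :: "'a set set \<Rightarrow> 'a \<Rightarrow> 'a set set" where
  "doubled F x = {B \<in> F. x \<notin> B \<and> insert x B \<in> F}"

text \<open>The edges of the one-inclusion graph with direction in \<open>S\<close>. Each edge is
  stored once, by its lower end and its direction.\<close>

definition edges :: "'a set set \<Rightarrow> 'a set \<Rightarrow> ('a set \<times> 'a) set" where
  "edges F S = {(B, i). i \<in> S \<and> i \<notin> B \<and> B \<in> F \<and> insert i B \<in> F}"

lemma set_shattersE:
  assumes "set_shatters F Y" "B \<subseteq> Y"
  obtains A where "A \<in> F" "A \<inter> Y = B"
  using assms unfolding set_shatters_def by blast

lemma set_shatters_subset:
  assumes "F \<subseteq> Pow S" "set_shatters F Y"
  shows "Y \<subseteq> S"
proof -
  obtain A where "A \<in> F" "A \<inter> Y = Y" using assms(2) unfolding set_shatters_def by blast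
  then show ?thesis using assms(1) by blast
qed

lemma set_shatters_mono:
  assumes "F \<subseteq> G" "set_shatters F Y"
  shows "set_shatters G Y"
  using assms unfolding set_shatters_def by (meson subsetD)

lemma vc_le_mono:
  assumes "vc_le d G" "F \<subseteq> G"
  shows "vc_le d F"
  using assms set_shatters_mono[OF assms(2)] unfolding vc_le_def by simp

section \<open>Deleting one coordinate: trace and doubled family\<close>

lemma vc_le_trace:
  assumes "vc_le d F"
  shows "vc_le d (trace F S)"
  unfolding vc_le_def
proof (intro allI impI)
  fix Y assume Y: "finite Y" "set_shatters (trace F S) Y"
  have "Y \<subseteq> S"
    by (rule set_shatters_subset[OF _ Y(2)]) (auto simp: trace_def)
  have "set_shatters F Y"
    unfolding set_shatters_def
  proof (intro allI impI)
    fix B assume "B \<subseteq> Y"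
    then obtain A where "A \<in> F" "A \<inter> S \<inter> Y = B"
      using Y(2) unfolding set_shatters_def trace_def by blast
    then show "\<exists>A\<in>F. A \<inter> Y = B"
      using \<open>Y \<subseteq> S\<close> by (metis Int_absorb1 Int_assoc)
  qed
  then show "card Y \<le> d"
    using assms Y(1) by (simp add: vc_le_def)
qed

text \<open>A set in \<open>doubled F x\<close> occurs in \<open>F\<close> both with and without
  \<open>x\<close>, so the value at \<open>x\<close> can be chosen freely. Hence the doubled family
  loses one dimension.\<close>

lemma doubled_shatters_insert:
  assumes "F \<subseteq> Pow (insert x S)" "set_shatters (doubled F x) Y"
  shows "x \<notin> Y" "set_shatters F (insert x Y)"
proof -
  obtain A where "A \<in> doubled F x" "A \<inter> Y = Y"
    using assms(2) unfolding set_shatters_def by blast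
  then show x: "x \<notin> Y" by (auto simp: doubled_def)
  show "set_shatters F (insert x Y)"
    unfolding set_shatters_def
  proof (intro allI impI)
    fix B assume B: "B \<subseteq> insert x Y"
    then have "B - {x} \<subseteq> Y" by blast
    then obtain A where A: "A \<in> doubled F x" "A \<inter> Y = B - {x}"
      using assms(2) unfolding set_shatters_def by blast
    show "\<exists>A\<in>F. A \<inter> insert x Y = B"
    proof (cases "x \<in> B")
      case True
      then have "insert x A \<inter> insert x Y = B" using A(2) by blast
      moreover have "insert x A \<in> F" using A(1) by (simp add: doubled_def)
      ultimately show ?thesis by blast
    next
      case False
      then have "A \<inter> insert x Y = B" using A by (auto simp: doubled_def)
      moreover have "A \<in> F" using A(1) by (simp add: doubled_def)
      ultimately show ?thesis by blast
    qed
  qed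
qed

lemma vc_le_doubled:
  assumes "F \<subseteq> Pow (insert x S)" "vc_le (Suc d) F"
  shows "vc_le d (doubled F x)"
  unfolding vc_le_def
proof (intro allI impI)
  fix Y assume Y: "finite Y" "set_shatters (doubled F x) Y"
  from doubled_shatters_insert[OF assms(1) Y(2)] show "card Y \<le> d"
    using assms(2) Y(1) unfolding vc_le_def by (metis Suc_le_mono card_insert_disjoint finite_insert)
qed

text \<open>The case \<open>d = 0\<close>, where no smaller dimension is left: a doubled set would
  make \<open>F\<close> shatter \<open>{x}\<close>.\<close>

lemma vc_le_0_doubled:
  assumes "F \<subseteq> Pow (insert x S)" "vc_le 0 F"
  shows "doubled F x = {}"
proof (rule ccontr)
  assume "doubled F x \<noteq> {}"
  then have "set_shatters (doubled F x) {}" by (auto simp: set_shatters_def)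
  from doubled_shatters_insert(2)[OF assms(1) this] have "card {x} \<le> 0"
    using assms(2) unfolding vc_le_def by blast
  then show False by simp
qed

text \<open>The inductions on the ground set rest on inclusion-exclusion for these two halves, once
  for members and once for edges.\<close>

lemma trace_split:
  assumes "F \<subseteq> Pow (insert x S)" "x \<notin> S"
  shows "trace F S = {A\<in>F. x \<notin> A} \<union> (\<lambda>A. A - {x}) ` {A\<in>F. x \<in> A}"
    and "doubled F x = {A\<in>F. x \<notin> A} \<inter> (\<lambda>A. A - {x}) ` {A\<in>F. x \<in> A}"
proof -
  have *: "A \<inter> S = A - {x}" if "A \<in> F" for A using that assms by blast
  show "trace F S = {A\<in>F. x \<notin> A} \<union> (\<lambda>A. A - {x}) ` {A\<in>F. x \<in> A}"
    unfolding trace_def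
  proof (intro equalityI subsetI)
    fix B assume "B \<in> (\<lambda>A. A \<inter> S) ` F"
    then obtain A where "A \<in> F" "B = A - {x}" using * by auto
    then show "B \<in> {A\<in>F. x \<notin> A} \<union> (\<lambda>A. A - {x}) ` {A\<in>F. x \<in> A}"
      by (cases "x \<in> A") auto
  next
    fix B assume "B \<in> {A\<in>F. x \<notin> A} \<union> (\<lambda>A. A - {x}) ` {A\<in>F. x \<in> A}"
    then have "\<exists>A\<in>F. B = A - {x}" by auto
    then show "B \<in> (\<lambda>A. A \<inter> S) ` F" using * by auto
  qed
  show "doubled F x = {A\<in>F. x \<notin> A} \<inter> (\<lambda>A. A - {x}) ` {A\<in>F. x \<in> A}"
  proof (intro equalityI subsetI)
    fix B assume "B \<in> doubled F x"
    then have "B \<in> F" "x \<notin> B" "insert x B \<in> {A\<in>F. x \<in> A}" "B = insert x B - {x}"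
      by (auto simp: doubled_def)
    then show "B \<in> {A\<in>F. x \<notin> A} \<inter> (\<lambda>A. A - {x}) ` {A\<in>F. x \<in> A}" by blast
  next
    fix B assume "B \<in> {A\<in>F. x \<notin> A} \<inter> (\<lambda>A. A - {x}) ` {A\<in>F. x \<in> A}"
    then obtain A where "B \<in> F" "x \<notin> B" "A \<in> F" "x \<in> A" "B = A - {x}" by blast
    then show "B \<in> doubled F x" by (simp add: doubled_def insert_absorb)
  qed
qed

lemma card_trace_doubled:
  assumes "F \<subseteq> Pow (insert x S)" "x \<notin> S" "finite S"
  shows "card F = card (trace F S) + card (doubled F x)"
proof -
  let ?F0 = "{A\<in>F. x \<notin> A}" and ?F1 = "{A\<in>F. x \<in> A}"
  have fin: "finite F" using assms(1,3) by (meson finite_Pow_iff finite_insert finite_subset)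
  have "inj_on (\<lambda>A. A - {x}) ?F1" by (intro inj_onI) blast
  then have "card ((\<lambda>A. A - {x}) ` ?F1) = card ?F1" by (rule card_image)
  moreover have "card F = card ?F0 + card ?F1"
    using fin by (subst card_Un_disjoint[symmetric]) (auto intro: arg_cong[where f=card])
  ultimately show ?thesis
    using card_Un_Int[of ?F0 "(\<lambda>A. A - {x}) ` ?F1"] fin
    unfolding trace_split[OF assms(1,2)] by simp
qed

text \<open>A weak form of the Sauer-Shelah lemma. With \<open>n\<close> the size of the smaller
  ground set, the induction adds \<open>(n + 1) ^ d\<close> and \<open>(n + 1) ^ (d - 1)\<close>,
  together \<open>(n + 2) * (n + 1) ^ (d - 1)\<close>.\<close>

lemma card_le_Suc_card_power:
  assumes "finite S" "F \<subseteq> Pow S" "vc_le d F"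
  shows "card F \<le> Suc (card S) ^ d"
  using assms
proof (induction S arbitrary: F d rule: finite_induct)
  case empty
  then have "card F \<le> card {{} :: 'a set}" by (intro card_mono) auto
  then show ?case by simp
next
  case (insert x S)
  have card: "card F = card (trace F S) + card (doubled F x)"
    by (rule card_trace_doubled[OF insert.prems(1) insert.hyps(2,1)])
  have tr: "card (trace F S) \<le> Suc (card S) ^ d"
    by (intro insert.IH vc_le_trace insert.prems) (auto simp: trace_def)
  show ?case
  proof (cases d)
    case 0
    then have "doubled F x = {}"
      using vc_le_0_doubled[OF insert.prems(1)] insert.prems(2) by simp
    then show ?thesis using card tr 0 by simp
  next
    case (Suc e)
    have "doubled F x \<subseteq> Pow S" using insert.prems(1) by (auto simp: doubled_def)
    then have db: "card (doubled F x) \<le> Suc (card S) ^ e"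
      using insert.prems(2) unfolding Suc
      by (intro insert.IH vc_le_doubled[OF insert.prems(1)])
    have "card F \<le> Suc (card S) * Suc (card S) ^ e + Suc (card S) ^ e"
      using card tr db Suc by simp
    also have "\<dots> = Suc (Suc (card S)) * Suc (card S) ^ e" by simp
    also have "\<dots> \<le> Suc (Suc (card S)) * Suc (Suc (card S)) ^ e"
      by (intro mult_left_mono power_mono) auto
    finally show ?thesis using insert.hyps Suc by simp
  qed
qed

section \<open>Edge density of one-inclusion graphs\<close>

lemma finite_edges:
  assumes "finite F" "finite S"
  shows "finite (edges F S)"
  by (rule finite_subset[of _ "F \<times> S"]) (use assms in \<open>auto simp: edges_def\<close>)

text \<open>Edges in direction \<open>x\<close> correspond to \<open>doubled F x\<close>; the others
  lie within one of the two halves of \<open>F\<close>. For \<open>d > 0\<close> the induction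
  bounds the total by \<open>d * card (trace F S) + (d - 1) * card (doubled F x) + card (doubled F
  x)\<close>, that is, by \<open>d * card F\<close>.\<close>

lemma card_edges_le:
  assumes "finite S" "F \<subseteq> Pow S" "vc_le d F"
  shows "card (edges F S) \<le> d * card F"
  using assms
proof (induction S arbitrary: F d rule: finite_induct)
  case empty
  then show ?case by (simp add: edges_def)
next
  case (insert x S)
  let ?F0 = "{A\<in>F. x \<notin> A}" and ?F1 = "(\<lambda>A. A - {x}) ` {A\<in>F. x \<in> A}"
  note split = trace_split[OF insert.prems(1) insert.hyps(2)]
  have fin: "finite F"
    using insert.prems(1) insert.hyps(1) by (meson finite_Pow_iff finite_insert finite_subset)
  have fin01: "finite (edges ?F0 S)" "finite (edges ?F1 S)"
    using fin insert.hyps(1) by (auto intro!: finite_edges)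
  have dir_x: "edges F {x} = (\<lambda>B. (B, x)) ` doubled F x"
    by (auto simp: edges_def doubled_def)
  have dir_S: "edges F S \<subseteq> edges ?F0 S \<union> (\<lambda>(B, i). (insert x B, i)) ` edges ?F1 S"
  proof
    fix e assume "e \<in> edges F S"
    then obtain B i where e: "e = (B, i)" "i \<in> S" "i \<notin> B" "B \<in> F" "insert i B \<in> F"
      by (auto simp: edges_def)
    have "i \<noteq> x" using e insert.hyps by auto
    show "e \<in> edges ?F0 S \<union> (\<lambda>(B, i). (insert x B, i)) ` edges ?F1 S"
    proof (cases "x \<in> B")
      case True
      have "B - {x} \<in> ?F1" using True e by auto
      moreover have "insert i B - {x} \<in> ?F1" using True e by auto
      then have "insert i (B - {x}) \<in> ?F1" using \<open>i \<noteq> x\<close> by (simp add: insert_Diff_if)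
      ultimately have "(B - {x}, i) \<in> edges ?F1 S" using e by (auto simp: edges_def)
      moreover have "e = (\<lambda>(B, i). (insert x B, i)) (B - {x}, i)" using True e by auto
      ultimately show ?thesis by blast
    next
      case False
      then show ?thesis using e \<open>i \<noteq> x\<close> by (auto simp: edges_def)
    qed
  qed
  have "edges F (insert x S) = edges F {x} \<union> edges F S" by (auto simp: edges_def)
  then have "card (edges F (insert x S)) \<le> card (edges F {x}) + card (edges F S)"
    by (simp add: card_Un_le)
  also have "card (edges F {x}) \<le> card (doubled F x)"
    unfolding dir_x using fin by (intro card_image_le) (auto simp: doubled_def)
  also have "card (edges F S) \<le> card (edges ?F0 S) + card (edges ?F1 S)"
  proof -
    have "card (edges F S) \<le> card (edges ?F0 S \<union> (\<lambda>(B, i). (insert x B, i)) ` edges ?F1 S)"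
      using fin01 by (intro card_mono dir_S) auto
    also have "\<dots> \<le> card (edges ?F0 S) + card ((\<lambda>(B, i). (insert x B, i)) ` edges ?F1 S)"
      by (rule card_Un_le)
    also have "\<dots> \<le> card (edges ?F0 S) + card (edges ?F1 S)"
      using fin01 by (intro add_left_mono card_image_le)
    finally show ?thesis .
  qed
  \<comment> \<open>The edges common to both halves are exactly the edges of their intersection. The
    union of the halves may have further edges from one half to the other, which is harmless for an
    upper bound.\<close>
  also have "\<dots> = card (edges ?F0 S \<union> edges ?F1 S) + card (edges ?F0 S \<inter> edges ?F1 S)"
    by (rule card_Un_Int[OF fin01])
  also have "edges ?F0 S \<inter> edges ?F1 S = edges (doubled F x) S"
    unfolding split by (auto simp: edges_def)
  also have "card (edges ?F0 S \<union> edges ?F1 S) \<le> card (edges (trace F S) S)"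
    unfolding split using fin insert.hyps by (intro card_mono finite_edges) (auto simp: edges_def)
  also have "card (edges (trace F S) S) \<le> d * card (trace F S)"
    by (intro insert.IH vc_le_trace insert.prems) (auto simp: trace_def)
  finally have le: "card (edges F (insert x S))
      \<le> card (doubled F x) + (d * card (trace F S) + card (edges (doubled F x) S))" by simp
  have card: "card F = card (trace F S) + card (doubled F x)"
    by (rule card_trace_doubled[OF insert.prems(1) insert.hyps(2,1)])
  show ?case
  proof (cases d)
    case 0
    then have "doubled F x = {}"
      using vc_le_0_doubled[OF insert.prems(1)] insert.prems(2) by simp
    then show ?thesis using le 0 by (simp add: edges_def)
  next
    case (Suc e)
    have "doubled F x \<subseteq> Pow S" using insert.prems(1) by (auto simp: doubled_def)
    then have "card (edges (doubled F x) S) \<le> e * card (doubled F x)"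
      using insert.prems(2) unfolding Suc
      by (intro insert.IH vc_le_doubled[OF insert.prems(1)])
    then show ?thesis using le card Suc by (simp add: algebra_simps)
  qed
qed

text \<open>Layer-cake decomposition: apply the unweighted bound to each superlevel family of the
  weight.\<close>

lemma weighted_edges_le:
  fixes w :: "'a set \<Rightarrow> nat"
  assumes "finite S" "F \<subseteq> Pow S" "vc_le d F"
  shows "(\<Sum>(B, i)\<in>edges F S. min (w B) (w (insert i B))) \<le> d * (\<Sum>B\<in>F. w B)"
proof -
  have fin: "finite F" using assms by (meson finite_Pow_iff finite_subset)
  \<comment> \<open>A common bound on the weights, so that all layers run over the same finite range
    \<open>t < K\<close>.\<close>
  define K where "K = (\<Sum>B\<in>F. w B)"
  have wK: "w B \<le> K" if "B \<in> F" for B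
    unfolding K_def using that fin by (simp add: member_le_sum)
  have layer: "(n::nat) = (\<Sum>t<K. of_bool (t < n))" if "n \<le> K" for n
  proof -
    have "{..<K} \<inter> {t. t < n} = {..<n}" using that by auto
    then show ?thesis by simp
  qed
  define L where "L t = {B\<in>F. t < w B}" for t
  have "(\<Sum>(B, i)\<in>edges F S. min (w B) (w (insert i B)))
      = (\<Sum>(B, i)\<in>edges F S. \<Sum>t<K. of_bool (t < min (w B) (w (insert i B))))"
  proof (intro sum.cong refl, clarify)
    fix B i assume "(B, i) \<in> edges F S"
    then have "min (w B) (w (insert i B)) \<le> K" using wK by (auto simp: edges_def min.coboundedI1)
    then show "min (w B) (w (insert i B)) = (\<Sum>t<K. of_bool (t < min (w B) (w (insert i B))))"
      by (rule layer)
  qed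
  also have "\<dots> = (\<Sum>t<K. \<Sum>(B, i)\<in>edges F S. of_bool (t < min (w B) (w (insert i B))))"
    unfolding case_prod_unfold by (rule sum.swap)
  also have "\<dots> = (\<Sum>t<K. card (edges (L t) S))"
  proof (intro sum.cong refl)
    fix t
    have "edges F S \<inter> {e. t < min (w (fst e)) (w (insert (snd e) (fst e)))} = edges (L t) S"
      by (auto simp: edges_def L_def)
    then show "(\<Sum>(B, i)\<in>edges F S. of_bool (t < min (w B) (w (insert i B)))) = card (edges (L t) S)"
      using finite_edges[OF fin assms(1)] by (simp add: case_prod_unfold)
  qed
  also have "\<dots> \<le> (\<Sum>t<K. d * card (L t))"
  proof (intro sum_mono card_edges_le assms(1))
    fix t
    show "L t \<subseteq> Pow S" using assms(2) by (auto simp: L_def)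
    show "vc_le d (L t)" by (rule vc_le_mono[OF assms(3)]) (auto simp: L_def)
  qed
  also have "\<dots> = d * (\<Sum>t<K. \<Sum>B\<in>F. of_bool (t < w B))"
    unfolding L_def using fin by (simp add: sum_distrib_left Int_def)
  also have "(\<Sum>t<K. \<Sum>B\<in>F. of_bool (t < w B)) = (\<Sum>B\<in>F. \<Sum>t<K. of_bool (t < w B))"
    by (rule sum.swap)
  also have "\<dots> = (\<Sum>B\<in>F. w B)"
    by (intro sum.cong refl layer[symmetric] wK)
  finally show ?thesis .
qed

section \<open>Packing\<close>

definition fiber :: "'a set set \<Rightarrow> 'a set \<Rightarrow> 'a set \<Rightarrow> 'a set set" where
  "fiber F I B = {A\<in>F. A \<inter> I = B}"

text \<open>The number of errors when membership of \<open>i\<close> is guessed from the trace on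
  \<open>I\<close> by majority vote.\<close>

definition split_weight :: "'a set set \<Rightarrow> 'a set \<Rightarrow> 'a \<Rightarrow> nat" where
  "split_weight F I i =
     (\<Sum>B\<in>trace F I. min (card {A\<in>fiber F I B. i \<notin> A}) (card {A\<in>fiber F I B. i \<in> A}))"

section \<open>Split weights bounded from above and from below\<close>

lemma sum_card_fiber:
  assumes "finite F"
  shows "(\<Sum>B\<in>trace F I. card (fiber F I B)) = card F"
proof -
  have "card F = (\<Sum>A\<in>F. 1)" by simp
  also have "\<dots> = (\<Sum>B\<in>(\<lambda>A. A \<inter> I) ` F. \<Sum>A\<in>{A\<in>F. A \<inter> I = B}. 1)"
    by (rule sum.image_gen[OF assms])
  finally show ?thesis by (simp add: trace_def fiber_def)
qed

text \<open>Each trace on \<open>J\<close> is weighted by the size of its fiber. Coordinate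
  \<open>i\<close> splits a fiber over \<open>J - {i}\<close> into the fibers of the two ends of an
  edge in direction \<open>i\<close>, so the split weights become edge weights in the one-inclusion
  graph of \<open>trace F J\<close>.\<close>

lemma sum_split_weight_le:
  assumes "finite S" "F \<subseteq> Pow S" "vc_le d F" "J \<subseteq> S"
  shows "(\<Sum>i\<in>J. split_weight F (J - {i}) i) \<le> d * card F"
proof -
  have fin: "finite F" "finite J" using assms by (auto intro: finite_subset)
  define w where "w B = card (fiber F J B)" for B
  define G where "G = trace F J"
  have G: "G \<subseteq> Pow J" "finite G" "vc_le d G"
    using fin vc_le_trace[OF assms(3)] by (auto simp: G_def trace_def)
  have w_pos: "B \<in> G" if "w B \<noteq> 0" for B
  proof -
    have "fiber F J B \<noteq> {}" using that by (auto simp: w_def)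
    then show ?thesis by (auto simp: fiber_def G_def trace_def)
  qed
  have "(\<Sum>i\<in>J. split_weight F (J - {i}) i)
      \<le> (\<Sum>i\<in>J. \<Sum>B\<in>Pow (J - {i}). min (w B) (w (insert i B)))"
  proof (intro sum_mono)
    fix i assume i: "i \<in> J"
    have "min (card {A\<in>fiber F (J - {i}) B. i \<notin> A}) (card {A\<in>fiber F (J - {i}) B. i \<in> A})
        = min (w B) (w (insert i B))" if "B \<in> trace F (J - {i})" for B
    proof -
      have "B \<subseteq> J - {i}" using that by (auto simp: trace_def)
      then have "{A\<in>fiber F (J - {i}) B. i \<notin> A} = fiber F J B"
        "{A\<in>fiber F (J - {i}) B. i \<in> A} = fiber F J (insert i B)"
        using i by (auto simp: fiber_def)
      then show ?thesis by (simp add: w_def)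
    qed
    then have "split_weight F (J - {i}) i
        = (\<Sum>B\<in>trace F (J - {i}). min (w B) (w (insert i B)))"
      unfolding split_weight_def by (rule sum.cong[OF refl])
    also have "\<dots> \<le> (\<Sum>B\<in>Pow (J - {i}). min (w B) (w (insert i B)))"
      using fin by (intro sum_mono2) (auto simp: trace_def)
    finally show "split_weight F (J - {i}) i
        \<le> (\<Sum>B\<in>Pow (J - {i}). min (w B) (w (insert i B)))" .
  qed
  also have "\<dots> = (\<Sum>(i, B)\<in>Sigma J (\<lambda>i. Pow (J - {i})). min (w B) (w (insert i B)))"
    using fin by (intro sum.Sigma) auto
  \<comment> \<open>Only edges contribute: otherwise one end lies outside \<open>G\<close>, its
    fiber is empty and the minimum is \<open>0\<close>.\<close>
  also have "\<dots> = (\<Sum>(i, B)\<in>prod.swap ` edges G J. min (w B) (w (insert i B)))"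
  proof (rule sum.mono_neutral_right)
    show "finite (Sigma J (\<lambda>i. Pow (J - {i})))" using fin by auto
    show "prod.swap ` edges G J \<subseteq> Sigma J (\<lambda>i. Pow (J - {i}))"
      using G(1) by (auto simp: edges_def)
    show "\<forall>e\<in>Sigma J (\<lambda>i. Pow (J - {i})) - prod.swap ` edges G J.
        (case e of (i, B) \<Rightarrow> min (w B) (w (insert i B))) = 0"
    proof
      fix e assume e: "e \<in> Sigma J (\<lambda>i. Pow (J - {i})) - prod.swap ` edges G J"
      obtain i B where iB: "e = (i, B)" by (cases e)
      have *: "i \<in> J" "B \<subseteq> J - {i}" using e iB by auto
      have "(B, i) \<notin> edges G J" using e iB by force
      then have "B \<notin> G \<or> insert i B \<notin> G" using * by (auto simp: edges_def)
      then show "(case e of (i, B) \<Rightarrow> min (w B) (w (insert i B))) = 0"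
        using w_pos iB by fastforce
    qed
  qed
  also have "\<dots> = (\<Sum>(B, i)\<in>edges G J. min (w B) (w (insert i B)))"
    by (subst sum.reindex) (auto simp: case_prod_unfold)
  also have "\<dots> \<le> d * (\<Sum>B\<in>G. w B)"
    by (rule weighted_edges_le[OF fin(2) G(1,3)])
  also have "(\<Sum>B\<in>G. w B) = card F"
    unfolding G_def w_def by (rule sum_card_fiber[OF fin(1)])
  finally show ?thesis .
qed

text \<open>Double counting of distances over ordered pairs. Each member is
  \<open>\<delta>\<close>-far from all others, while a coordinate with sides of sizes
  \<open>p\<close> and \<open>q\<close> separates \<open>2 * p * q\<close> pairs, at most
  \<open>2 * card \<Phi> * min p q\<close>. Cancelling \<open>card \<Phi>\<close> leaves a loss of
  one \<open>\<delta>\<close>.\<close>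

lemma separated_le_sum_min:
  assumes "finite \<Phi>" "\<Phi> \<noteq> {}" "finite R"
    and sep: "\<And>A A'. A \<in> \<Phi> \<Longrightarrow> A' \<in> \<Phi> \<Longrightarrow> A \<noteq> A' \<Longrightarrow> \<delta> \<le> card (sym_diff A A' \<inter> R)"
  shows "\<delta> * card \<Phi> \<le> 2 * (\<Sum>i\<in>R. min (card {A\<in>\<Phi>. i \<notin> A}) (card {A\<in>\<Phi>. i \<in> A})) + \<delta>"
proof -
  define w where "w = card \<Phi>"
  define p where "p i = card {A\<in>\<Phi>. i \<in> A}" for i
  define q where "q i = card {A\<in>\<Phi>. i \<notin> A}" for i
  have w: "w > 0" using assms by (simp add: w_def card_gt_0_iff)
  have pq: "p i + q i = w" for i
    unfolding p_def q_def w_def using assms(1)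
    by (subst card_Un_disjoint[symmetric]) (auto intro: arg_cong[where f=card])
  have row: "(w - 1) * \<delta> \<le> (\<Sum>A'\<in>\<Phi>. card (sym_diff A A' \<inter> R))" if "A \<in> \<Phi>" for A
  proof -
    have "(w - 1) * \<delta> = (\<Sum>A'\<in>\<Phi> - {A}. \<delta>)" using that by (simp add: w_def)
    also have "\<dots> \<le> (\<Sum>A'\<in>\<Phi> - {A}. card (sym_diff A A' \<inter> R))"
      using that by (intro sum_mono sep) auto
    also have "\<dots> \<le> (\<Sum>A'\<in>\<Phi>. card (sym_diff A A' \<inter> R))"
      using assms(1) by (intro sum_mono2) auto
    finally show ?thesis .
  qed
  have "w * ((w - 1) * \<delta>) = (\<Sum>A\<in>\<Phi>. (w - 1) * \<delta>)" by (simp add: w_def)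
  also have "\<dots> \<le> (\<Sum>A\<in>\<Phi>. \<Sum>A'\<in>\<Phi>. card (sym_diff A A' \<inter> R))"
    by (intro sum_mono row)
  also have "\<dots> = (\<Sum>A\<in>\<Phi>. \<Sum>A'\<in>\<Phi>. \<Sum>i\<in>R. of_bool ((i \<in> A) \<noteq> (i \<in> A')))"
  proof (intro sum.cong refl)
    fix A A' :: "'a set"
    have "sym_diff A A' \<inter> R = R \<inter> {i. (i \<in> A) \<noteq> (i \<in> A')}" by blast
    then show "card (sym_diff A A' \<inter> R) = (\<Sum>i\<in>R. of_bool ((i \<in> A) \<noteq> (i \<in> A')))"
      using assms(3) by simp
  qed
  also have "\<dots> = (\<Sum>A\<in>\<Phi>. \<Sum>i\<in>R. \<Sum>A'\<in>\<Phi>. of_bool ((i \<in> A) \<noteq> (i \<in> A')))"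
    by (intro sum.cong refl sum.swap)
  also have "\<dots> = (\<Sum>i\<in>R. \<Sum>A\<in>\<Phi>. \<Sum>A'\<in>\<Phi>. of_bool ((i \<in> A) \<noteq> (i \<in> A')))"
    by (rule sum.swap)
  also have "\<dots> = (\<Sum>i\<in>R. 2 * (p i * q i))"
  proof (intro sum.cong refl)
    fix i
    have "(\<Sum>A'\<in>\<Phi>. of_bool ((i \<in> A) \<noteq> (i \<in> A'))) = (if i \<in> A then q i else p i)" for A
      using assms(1) by (simp add: p_def q_def Int_def conj_commute)
    then have "(\<Sum>A\<in>\<Phi>. \<Sum>A'\<in>\<Phi>. of_bool ((i \<in> A) \<noteq> (i \<in> A')))
        = (\<Sum>A\<in>\<Phi>. if i \<in> A then q i else p i)" by simp
    also have "\<dots> = p i * q i + q i * p i"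
      using assms(1) by (simp add: sum.If_cases p_def q_def Int_def conj_commute)
    finally show "(\<Sum>A\<in>\<Phi>. \<Sum>A'\<in>\<Phi>. of_bool ((i \<in> A) \<noteq> (i \<in> A'))) = 2 * (p i * q i)"
      by simp
  qed
  also have "\<dots> \<le> (\<Sum>i\<in>R. 2 * (w * min (q i) (p i)))"
  proof (intro sum_mono mult_left_mono)
    fix i
    show "p i * q i \<le> w * min (q i) (p i)"
      using pq[of i] by (auto simp: min_def algebra_simps intro!: mult_mono)
  qed simp
  also have "\<dots> = w * (2 * (\<Sum>i\<in>R. min (q i) (p i)))"
    by (simp add: sum_distrib_left algebra_simps)
  finally have "(w - 1) * \<delta> \<le> 2 * (\<Sum>i\<in>R. min (q i) (p i))" using w by simp
  moreover have "\<delta> * w = (w - 1) * \<delta> + \<delta>" using w by (cases w) simp_all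
  ultimately show ?thesis unfolding p_def q_def w_def by linarith
qed

text \<open>The previous bound is applied to each fiber over \<open>I\<close>: its members agree on
  \<open>I\<close>, so their distances are visible in \<open>S - I\<close>. Every fiber loses one
  \<open>\<delta>\<close>, whence the last term.\<close>

lemma separated_le_sum_split_weight:
  assumes "finite S" "F \<subseteq> Pow S" "I \<subseteq> S"
    and sep: "\<And>A A'. A \<in> F \<Longrightarrow> A' \<in> F \<Longrightarrow> A \<noteq> A' \<Longrightarrow> \<delta> \<le> card (sym_diff A A')"
  shows "\<delta> * card F \<le> 2 * (\<Sum>i\<in>S - I. split_weight F I i) + \<delta> * card (trace F I)"
proof -
  have fin: "finite F" using assms(1,2) by (meson finite_Pow_iff finite_subset)
  let ?min = "\<lambda>B i. min (card {A\<in>fiber F I B. i \<notin> A}) (card {A\<in>fiber F I B. i \<in> A})"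
  have "\<delta> * card F = (\<Sum>B\<in>trace F I. \<delta> * card (fiber F I B))"
    by (simp add: sum_distrib_left[symmetric] sum_card_fiber[OF fin])
  also have "\<dots> \<le> (\<Sum>B\<in>trace F I. 2 * (\<Sum>i\<in>S - I. ?min B i) + \<delta>)"
  proof (intro sum_mono separated_le_sum_min)
    fix B assume B: "B \<in> trace F I"
    show "finite (fiber F I B)" using fin by (simp add: fiber_def)
    show "fiber F I B \<noteq> {}" using B by (auto simp: fiber_def trace_def)
    show "finite (S - I)" using assms(1) by simp
    fix A A' assume A: "A \<in> fiber F I B" "A' \<in> fiber F I B" "A \<noteq> A'"
    then have "A \<inter> I = A' \<inter> I" "A \<subseteq> S" "A' \<subseteq> S" using assms(2) by (auto simp: fiber_def)
    then have "sym_diff A A' \<inter> (S - I) = sym_diff A A'" by blast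
    then show "\<delta> \<le> card (sym_diff A A' \<inter> (S - I))" using sep A by (simp add: fiber_def)
  qed
  also have "\<dots> = 2 * (\<Sum>B\<in>trace F I. \<Sum>i\<in>S - I. ?min B i) + \<delta> * card (trace F I)"
    by (simp add: sum.distrib sum_distrib_left)
  also have "(\<Sum>B\<in>trace F I. \<Sum>i\<in>S - I. ?min B i) = (\<Sum>i\<in>S - I. split_weight F I i)"
    unfolding split_weight_def by (rule sum.swap)
  finally show ?thesis .
qed

text \<open>Choosing \<open>J\<close> and a last point in it amounts to choosing \<open>I\<close>
  and a point outside it. This links the upper bound, which fixes \<open>J\<close>, to the lower
  bound, which fixes \<open>I\<close>.\<close>

lemma sum_subsets_remove_eq:
  assumes "finite S"
  shows "(\<Sum>J | J \<subseteq> S \<and> card J = Suc k. \<Sum>i\<in>J. g (J - {i}) i)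
       = (\<Sum>I | I \<subseteq> S \<and> card I = k. \<Sum>i\<in>S - I. g I i)"
proof -
  have fin: "finite {J. J \<subseteq> S \<and> card J = n}" for n
    by (rule finite_subset[of _ "Pow S"]) (use assms in auto)
  have "(\<Sum>J | J \<subseteq> S \<and> card J = Suc k. \<Sum>i\<in>J. g (J - {i}) i)
      = (\<Sum>(J, i)\<in>Sigma {J. J \<subseteq> S \<and> card J = Suc k} (\<lambda>J. J). g (J - {i}) i)"
    by (rule sum.Sigma) (use fin assms in \<open>auto intro: finite_subset\<close>)
  also have "\<dots> = (\<Sum>(I, i)\<in>Sigma {I. I \<subseteq> S \<and> card I = k} (\<lambda>I. S - I). g I i)"
    by (rule sum.reindex_bij_witness[where j = "\<lambda>(J, i). (J - {i}, i)"
          and i = "\<lambda>(I, i). (insert i I, i)"])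
      (use assms in \<open>auto simp: insert_absorb card_insert_if dest: finite_subset\<close>)
  also have "\<dots> = (\<Sum>I | I \<subseteq> S \<and> card I = k. \<Sum>i\<in>S - I. g I i)"
    by (rule sum.Sigma[symmetric]) (use fin assms in auto)
  finally show ?thesis .
qed

text \<open>Haussler's packing argument, with the random sample replaced by double counting: summing
  the split weights over all samples of size \<^term>\<open>m\<close> and over the choice of the last sampled
  point gives both an upper bound (one-inclusion edge density) and a lower bound
  (separation).\<close>

lemma separated_card_less:
  assumes "finite S" "F \<subseteq> Pow S" "vc_le d F" "F \<noteq> {}"
    and sep: "\<And>A A'. A \<in> F \<Longrightarrow> A' \<in> F \<Longrightarrow> A \<noteq> A' \<Longrightarrow> \<delta> \<le> card (sym_diff A A')"
    and m: "0 < m" "m \<le> card S" "4 * d * card S < m * \<delta>"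
  shows "card F < 2 * m ^ d"
proof (rule ccontr)
  assume big: "\<not> card F < 2 * m ^ d"
  have fin: "finite F" using assms(1,2) by (meson finite_Pow_iff finite_subset)
  have M: "card F > 0" using fin assms(4) by (simp add: card_gt_0_iff)
  obtain k where k: "m = Suc k" using m(1) by (cases m) auto
  let ?n = "card S"
  \<comment> \<open>A sample of size \<open>k\<close> has at most \<open>m ^ d\<close> traces, by
    \<open>big\<close> no more than half of \<open>card F\<close>. So the loss term is at most half
    of the left side and can be absorbed there.\<close>
  have low: "\<delta> * card F \<le> 4 * (\<Sum>i\<in>S - I. split_weight F I i)"
    if "I \<subseteq> S" "card I = k" for I
  proof -
    have "card (trace F I) \<le> Suc (card I) ^ d"
      using that assms(1) by (intro card_le_Suc_card_power vc_le_trace[OF assms(3)])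
        (auto simp: trace_def intro: finite_subset)
    then have "2 * card (trace F I) \<le> card F" using big that k by simp
    then have "\<delta> * (2 * card (trace F I)) \<le> \<delta> * card F" by (rule mult_left_mono) simp
    then show ?thesis
      using separated_le_sum_split_weight[OF assms(1,2) that(1) sep] by linarith
  qed
  have "(?n choose k) * (\<delta> * card F) = (\<Sum>I | I \<subseteq> S \<and> card I = k. \<delta> * card F)"
    by (simp add: n_subsets[OF assms(1)])
  also have "\<dots> \<le> (\<Sum>I | I \<subseteq> S \<and> card I = k. 4 * (\<Sum>i\<in>S - I. split_weight F I i))"
    by (intro sum_mono low) auto
  also have "\<dots> = 4 * (\<Sum>J | J \<subseteq> S \<and> card J = Suc k. \<Sum>i\<in>J. split_weight F (J - {i}) i)"
    by (simp add: sum_subsets_remove_eq[OF assms(1)] sum_distrib_left)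
  also have "\<dots> \<le> 4 * (\<Sum>J | J \<subseteq> S \<and> card J = Suc k. d * card F)"
    by (intro mult_left_mono sum_mono sum_split_weight_le[OF assms(1-3)]) auto
  also have "\<dots> = 4 * ((?n choose Suc k) * (d * card F))"
    by (simp add: n_subsets[OF assms(1)])
  finally have "((?n choose k) * \<delta>) * card F \<le> (4 * d * (?n choose Suc k)) * card F"
    by (simp only: ac_simps)
  then have "(?n choose k) * \<delta> \<le> 4 * d * (?n choose Suc k)" using M by simp
  then have "m * ((?n choose k) * \<delta>) \<le> m * (4 * d * (?n choose Suc k))"
    by (rule mult_left_mono) simp
  also have "\<dots> = 4 * d * (Suc k * (?n choose Suc k))" by (simp only: k ac_simps)
  \<comment> \<open>This makes the binomial coefficients cancel; only
    \<open>m * \<delta> \<le> 4 * d * (?n - k)\<close> remains.\<close>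
  also have "Suc k * (?n choose Suc k) = (?n choose k) * (?n - k)"
    by (metis mult.commute binomial_absorption binomial_absorb_comp)
  finally have "(?n choose k) * (m * \<delta>) \<le> (?n choose k) * (4 * d * (?n - k))"
    by (simp only: ac_simps)
  moreover have "?n choose k > 0" using m(2) k by simp
  ultimately have "m * \<delta> \<le> 4 * d * (?n - k)" by simp
  also have "\<dots> \<le> 4 * d * ?n" by simp
  finally show False using m(3) by simp
qed

text \<open>Otherwise all distances exceed the bound, and \<open>separated_card_less\<close> with a
  sample size just above \<open>4 * d * card S / \<delta>\<close> makes \<open>F\<close> too small.
  The summand \<open>4 * d\<close> keeps this sample size at most \<open>card S\<close>.\<close>

lemma exists_close_pair:
  assumes "finite S" "F \<subseteq> Pow S" "vc_le d F" "2 \<le> card F" "0 < d"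
  obtains A A' where "A \<in> F" "A' \<in> F" "A \<noteq> A'"
    "real (card (sym_diff A A')) \<le> 4 * real d + 16 * real d * card S * card F powr - (1 / d)"
proof -
  define x where "x = 4 * real d + 16 * real d * card S * card F powr - (1 / d)"
  \<comment> \<open>The least integer above \<open>x\<close>: distances larger than \<open>x\<close>
    are at least \<open>\<delta>\<close>.\<close>
  define \<delta> where "\<delta> = Suc (nat \<lfloor>x\<rfloor>)"
  have x: "0 \<le> x" "4 * real d \<le> x" by (auto simp: x_def)
  have xd: "x < \<delta>" using x(1) unfolding \<delta>_def by linarith
  have False if far: "\<And>A A'. A \<in> F \<Longrightarrow> A' \<in> F \<Longrightarrow> A \<noteq> A' \<Longrightarrow> real (card (sym_diff A A')) > x"
  proof -
    have sep: "\<delta> \<le> card (sym_diff A A')" if "A \<in> F" "A' \<in> F" "A \<noteq> A'" for A A'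
      using far[OF that] x(1) unfolding \<delta>_def by linarith
    obtain A A' where AA: "A \<in> F" "A' \<in> F" "A \<noteq> A'"
      using assms(4) by (metis card_le_Suc0_iff_eq card.infinite not_less_eq_eq
          numeral_2_eq_2 zero_le)
    have "card (sym_diff A A') \<le> card S"
      using AA assms(1,2) by (intro card_mono) auto
    then have dn: "\<delta> \<le> card S" using sep[OF AA] by simp
    define y where "y = 4 * d * card S / real \<delta>"
    have d0: "real \<delta> > 0" by (simp add: \<delta>_def)
    have d4: "4 * real d < \<delta>" using x xd by linarith
    have n0: "card S > 0" using dn by (simp add: \<delta>_def)
    define m where "m = Suc (nat \<lfloor>y\<rfloor>)"
    have "y < card S"
      unfolding y_def using d0 d4 n0 by (simp add: divide_less_eq mult.commute)
    moreover have y0: "0 \<le> y" by (simp add: y_def)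
    ultimately have mn: "m \<le> card S" unfolding m_def by linarith
    have my: "y < m" "m \<le> y + 1" using y0 unfolding m_def by linarith+
    have "4 * real d * card S < m * \<delta>" using my(1) d0 by (simp add: y_def divide_less_eq)
    then have "real (4 * d * card S) < real (m * \<delta>)" by simp
    then have m\<delta>: "4 * d * card S < m * \<delta>" using of_nat_less_iff by blast
    have "F \<noteq> {}" using AA by auto
    then have "card F < 2 * m ^ d"
      using mn m\<delta> by (intro separated_card_less[OF assms(1-3) _ sep]) (auto simp: m_def)
    then have "real (card F) < 2 * real m ^ d"
      by (metis of_nat_less_iff of_nat_mult of_nat_numeral of_nat_power)
    also have "\<dots> \<le> 2 ^ d * real m ^ d"
      using assms(5) by (intro mult_right_mono) (auto simp: self_le_power)
    also have "\<dots> = (2 * real m) ^ d" by (simp add: power_mult_distrib)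
    \<comment> \<open>Since \<open>\<delta> \<le> card S\<close> gives \<open>y \<ge> 1\<close>,
      rounding up costs a factor \<open>2\<close>: \<open>m \<le> y + 1 \<le> 2 * y\<close>.\<close>
    also have "\<dots> \<le> (16 * d * card S / \<delta>) ^ d"
    proof (intro power_mono)
      have "real \<delta> \<le> real (card S)" using dn by simp
      also have "\<dots> \<le> 4 * d * card S"
        using assms(5) mult_right_mono[of 1 "4 * real d" "card S"] by simp
      finally have "1 \<le> y" using d0 by (simp add: y_def)
      then have "2 * real m \<le> 4 * y" using my(2) by linarith
      then show "2 * real m \<le> 16 * d * card S / \<delta>" by (simp add: y_def)
    qed simp
    finally have *: "real (card F) < (16 * d * card S / \<delta>) ^ d" .
    have M: "real (card F) > 0" using assms(4) by simp
    have "card F powr (1 / d) < ((16 * d * card S / \<delta>) ^ d) powr (1 / d)"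
      using * assms(5) by (intro powr_less_mono2) auto
    also have "\<dots> = 16 * d * card S / \<delta>"
      using assms(5) n0 d0 by (simp add: powr_realpow[symmetric] powr_powr)
    finally have "\<delta> * card F powr (1 / d) < 16 * d * card S"
      using d0 by (simp add: field_simps)
    then have "\<delta> < 16 * d * card S * card F powr - (1 / d)"
      using M by (simp add: powr_minus field_simps)
    then show False using xd by (simp add: x_def)
  qed
  then show thesis using that unfolding x_def by (meson not_less)
qed

section \<open>Connected supersets\<close>

text \<open>Connected subsets of the cube \<^term>\<open>Pow S\<close> that arise from one vertex by attaching at most
  \<^term>\<open>t\<close> further vertices, each adjacent to an earlier one.\<close>

primrec grown :: "'a set \<Rightarrow> nat \<Rightarrow> 'a set set set" where
  "grown S 0 = (\<lambda>A. {A}) ` Pow S"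
| "grown S (Suc t) = grown S t \<union>
     (\<lambda>(W, A, i). insert (sym_diff A {i}) W) ` Sigma (grown S t) (\<lambda>W. W \<times> S)"

lemma grown_mono:
  assumes "s \<le> t"
  shows "grown S s \<subseteq> grown S t"
  using assms by (induction rule: dec_induct) auto

lemma grown_Suc_insert:
  assumes "W \<in> grown S t" "A \<in> W" "i \<in> S"
  shows "insert (sym_diff A {i}) W \<in> grown S (Suc t)"
  unfolding grown.simps
  by (rule UnI2, rule image_eqI[where x = "(W, A, i)"]) (use assms in auto)

section \<open>Counting grown sets and extending them along paths\<close>

lemma card_grown_member:
  assumes "W \<in> grown S t"
  shows "finite W \<and> card W \<le> Suc t"
  using assms
proof (induction t arbitrary: W)
  case (Suc t)
  then show ?case by (fastforce simp: card_insert_if)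
qed auto

text \<open>A step adds nothing, or picks one of at most \<open>t + 1\<close> vertices and one of
  \<open>card S\<close> directions; it multiplies the count by at most
  \<open>1 + (t + 1) * card S\<close>.\<close>

lemma card_grown:
  assumes "finite S"
  shows "finite (grown S t) \<and> card (grown S t) \<le> 2 ^ card S * (1 + t * card S) ^ t"
proof (induction t)
  case 0
  have "card (grown S 0) \<le> card (Pow S)"
    using assms by (simp add: card_image_le)
  then show ?case using assms by (simp add: card_Pow)
next
  case (Suc t)
  have fin: "finite (grown S t)" using Suc by simp
  let ?P = "Sigma (grown S t) (\<lambda>W. W \<times> S)"
  have finP: "finite ?P" using fin assms card_grown_member by blast
  have "card ?P = (\<Sum>W\<in>grown S t. card (W \<times> S))"
    by (rule card_SigmaI) (use fin assms card_grown_member in auto)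
  also have "\<dots> \<le> (\<Sum>W\<in>grown S t. Suc t * card S)"
    unfolding card_cartesian_product using card_grown_member
    by (intro sum_mono mult_right_mono) auto
  also have "\<dots> = card (grown S t) * (Suc t * card S)" by simp
  finally have P: "card ?P \<le> card (grown S t) * (Suc t * card S)" .
  have "card (grown S (Suc t))
      \<le> card (grown S t) + card ((\<lambda>(W, A, i). insert (sym_diff A {i}) W) ` ?P)"
    by (simp only: grown.simps card_Un_le)
  also have "\<dots> \<le> card (grown S t) + card ?P"
    by (intro add_left_mono card_image_le finP)
  also have "\<dots> \<le> card (grown S t) + card (grown S t) * (Suc t * card S)"
    using P by simp
  also have "\<dots> = card (grown S t) * (1 + Suc t * card S)"
    by (simp only: distrib_left mult_1_right)
  also have "\<dots> \<le> (2 ^ card S * (1 + t * card S) ^ t) * (1 + Suc t * card S)"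
    using Suc by (intro mult_right_mono) auto
  also have "\<dots> \<le> (2 ^ card S * (1 + Suc t * card S) ^ t) * (1 + Suc t * card S)"
    by (intro mult_right_mono mult_left_mono power_mono) auto
  also have "\<dots> = 2 ^ card S * (1 + Suc t * card S) ^ Suc t"
    by (simp only: power_Suc ac_simps)
  finally show ?case using fin finP by simp
qed

text \<open>The coordinates in which \<open>A\<close> and \<open>B\<close> differ are flipped one at
  a time, one step per flip.\<close>

lemma grown_path:
  assumes "finite S" "W \<in> grown S t" "A \<in> W" "A \<subseteq> S" "B \<subseteq> S"
  shows "\<exists>W'\<in>grown S (t + card (sym_diff A B)). insert B W \<subseteq> W'"
  using assms(2-)
proof (induction "card (sym_diff A B)" arbitrary: W t A)
  case 0
  have "finite (sym_diff A B)"
    using assms(1) 0 by (meson Diff_subset Un_least finite_subset order_trans)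
  then have "A = B" using 0 by auto
  then show ?case using 0 by (auto simp: insert_absorb)
next
  case (Suc n)
  have fin: "finite (sym_diff A B)"
    using assms(1) Suc by (meson Diff_subset Un_least finite_subset order_trans)
  have "sym_diff A B \<noteq> {}"
  proof
    assume "sym_diff A B = {}"
    then have "card (sym_diff A B) = 0" by (simp only: card.empty)
    then show False using Suc(2) by simp
  qed
  then obtain i where i: "i \<in> sym_diff A B" by blast
  let ?A = "sym_diff A {i}"
  have iS: "i \<in> S" using i Suc.prems by blast
  have eq: "sym_diff ?A B = sym_diff A B - {i}" using i by blast
  have c: "card (sym_diff ?A B) = n"
    unfolding eq using i fin Suc(2) by (simp only: card_Diff_singleton)
  have "insert ?A W \<in> grown S (Suc t)" using Suc.prems(1,2) iS by (rule grown_Suc_insert)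
  moreover have "?A \<subseteq> S" using Suc.prems iS by blast
  ultimately have "\<exists>W'\<in>grown S (Suc t + card (sym_diff ?A B)). insert B (insert ?A W) \<subseteq> W'"
    by (intro Suc.hyps(1)[OF c[symmetric]] insertI1 Suc.prems(4))
  then obtain W' where "W' \<in> grown S (Suc t + n)" "insert B (insert ?A W) \<subseteq> W'"
    unfolding c by blast
  moreover have "Suc t + n = t + card (sym_diff A B)" using Suc(2) by linarith
  ultimately have "W' \<in> grown S (t + card (sym_diff A B))" "insert B W \<subseteq> W'"
    by (simp only:, blast)
  then show ?case by (rule bexI[rotated])
qed

text \<open>With \<open>e = 1 - 1 / d\<close>, concavity of \<open>x powr e\<close> bounds the
  increment from \<open>x - 1\<close> to \<open>x\<close> below by the derivative at
  \<open>x\<close>, and \<open>d \<ge> 2\<close> gives \<open>e \<ge> 1 / 2\<close>. This makes the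
  distances telescope when members are removed one by one.\<close>

lemma powr_diff_ge_half:
  fixes x :: real and d :: nat
  assumes "1 \<le> x" "2 \<le> d"
  shows "x powr - (1 / d) \<le> 2 * (x powr (1 - 1 / d) - (x - 1) powr (1 - 1 / d))"
proof -
  define e :: real where "e = 1 - 1 / d"
  have e: "1 / 2 \<le> e" "e \<le> 1" using assms(2) by (auto simp: e_def field_simps)
  have "(1 - 1 / x) powr e \<le> 1 - e / x"
  proof (cases "x = 1")
    case True
    then show ?thesis using e by simp
  next
    case False
    then have x: "x > 1" using assms(1) by simp
    define u where "u = 1 - 1 / x"
    define L where "L = 1 - e / x"
    have u: "u > 0" using x by (simp add: u_def)
    have "e / x \<le> 1 / x" using e x by (intro divide_right_mono) auto
    also have "\<dots> < 1" using x by simp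
    finally have L: "L > 0" by (simp add: L_def)
    \<comment> \<open>Bernoulli's inequality as weighted AM-GM: \<open>L\<close> is the mean of
      \<open>u\<close> and \<open>1\<close> with weights \<open>e\<close> and \<open>1 - e\<close>,
      and \<open>ln z \<le> z - 1\<close> is used at \<open>u / L\<close> and
      \<open>1 / L\<close>.\<close>
    have "ln u - ln L \<le> u / L - 1" "- ln L \<le> 1 / L - 1"
      using ln_le_minus_one[of "u / L"] ln_le_minus_one[of "1 / L"] u L by (simp_all add: ln_div)
    then have "e * (ln u - ln L) + (1 - e) * (- ln L) \<le> e * (u / L - 1) + (1 - e) * (1 / L - 1)"
      using e by (intro add_mono mult_left_mono) auto
    also have "\<dots> = (e * u + (1 - e)) / L - 1"
      by (simp add: add_divide_distrib diff_divide_distrib algebra_simps)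
    also have "e * u + (1 - e) = L" by (simp add: u_def L_def algebra_simps)
    finally have "e * ln u \<le> ln L" using L by (simp add: algebra_simps)
    then have "exp (e * ln u) \<le> exp (ln L)" by simp
    then have "u powr e \<le> L" using u L by (simp add: powr_def)
    then show ?thesis by (simp add: u_def L_def)
  qed
  then have "x powr e * (1 - 1 / x) powr e \<le> x powr e * (1 - e / x)"
    by (intro mult_left_mono) auto
  moreover have "x powr e * (1 - 1 / x) powr e = (x - 1) powr e"
  proof -
    have "x powr e * (1 - 1 / x) powr e = (x * (1 - 1 / x)) powr e"
      by (rule powr_mult[symmetric])
    also have "x * (1 - 1 / x) = x - 1" using assms(1) by (simp add: field_simps)
    finally show ?thesis .
  qed
  moreover have "x powr e * (1 - e / x) = x powr e - e * x powr (e - 1)"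
    using assms(1) by (simp add: powr_diff algebra_simps)
  ultimately have "e * x powr (e - 1) \<le> x powr e - (x - 1) powr e" by linarith
  moreover have "1 / 2 * x powr (e - 1) \<le> e * x powr (e - 1)"
    using e by (intro mult_right_mono) auto
  ultimately have "x powr (e - 1) \<le> 2 * (x powr e - (x - 1) powr e)"
    unfolding right_diff_distrib by linarith
  moreover have "e - 1 = - (1 / d)" by (simp add: e_def)
  ultimately show ?thesis by (simp only: e_def)
qed

text \<open>Induction on \<open>card F\<close>: one member of a close pair is removed and rejoined
  by a path. This costs at most \<open>4 * d\<close> plus, by \<open>powr_diff_ge_half\<close>, the
  increase of the second summand.\<close>

lemma vc_le_subset_grown:
  assumes "finite S" "F \<subseteq> Pow S" "vc_le d F" "F \<noteq> {}" "2 \<le> d"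
  shows "\<exists>t. \<exists>W\<in>grown S t. F \<subseteq> W \<and>
    real t \<le> 4 * real d * card F + 32 * real d * card S * card F powr (1 - 1 / d)"
  using assms(2-4)
proof (induction "card F" arbitrary: F)
  case 0
  have "finite F" using 0(2) assms(1) by (meson finite_Pow_iff finite_subset)
  then show ?case using 0 by simp
next
  case (Suc M)
  have fin: "finite F" using Suc.prems(1) assms(1) by (meson finite_Pow_iff finite_subset)
  show ?case
  proof (cases "M = 0")
    case True
    then obtain A where A: "F = {A}" using Suc(2) by (metis One_nat_def card_1_singletonE)
    then have "F \<in> grown S 0" using Suc.prems(1) by auto
    then show ?thesis by (intro exI[of _ 0] bexI[of _ F]) auto
  next
    case False
    have "2 \<le> card F" "0 < d" using False Suc(2) assms(5) by linarith+
    from exists_close_pair[OF assms(1) Suc.prems(1,2) this]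
    obtain A B where AB: "A \<in> F" "B \<in> F" "A \<noteq> B"
      "real (card (sym_diff A B)) \<le> 4 * real d + 16 * real d * card S * card F powr - (1 / d)" .
    let ?G = "F - {B}"
    have G: "M = card ?G" using Suc(2) AB(2) fin by simp
    have "\<exists>t. \<exists>W\<in>grown S t. ?G \<subseteq> W \<and>
        real t \<le> 4 * real d * card ?G + 32 * real d * card S * card ?G powr (1 - 1 / d)"
    proof (rule Suc.hyps(1)[OF G])
      show "?G \<subseteq> Pow S" using Suc.prems(1) by blast
      show "vc_le d ?G" by (rule vc_le_mono[OF Suc.prems(2)]) blast
      show "?G \<noteq> {}" using AB by blast
    qed
    then obtain t W where W: "W \<in> grown S t" "?G \<subseteq> W"
      "real t \<le> 4 * real d * M + 32 * real d * card S * M powr (1 - 1 / d)"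
      unfolding G[symmetric] by blast
    have "A \<in> W" "A \<subseteq> S" "B \<subseteq> S" using AB W(2) Suc.prems(1) by blast+
    then obtain W' where W': "W' \<in> grown S (t + card (sym_diff A B))" "insert B W \<subseteq> W'"
      using grown_path[OF assms(1) W(1)] by blast
    have "F \<subseteq> W'" using W'(2) W(2) by blast
    moreover have "real (t + card (sym_diff A B))
        \<le> 4 * real d * card F + 32 * real d * card S * card F powr (1 - 1 / d)"
    proof -
      have M: "real M = real (card F) - 1" using Suc(2) by linarith
      have "real (card F) powr - (1 / d)
          \<le> 2 * (real (card F) powr (1 - 1 / d) - (real (card F) - 1) powr (1 - 1 / d))"
        by (rule powr_diff_ge_half) (use Suc(2) assms(5) in linarith)+
      then have "16 * real d * card S * real (card F) powr - (1 / d)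
          \<le> 16 * real d * card S * (2 * (real (card F) powr (1 - 1 / d) - M powr (1 - 1 / d)))"
        unfolding M by (intro mult_left_mono) auto
      then show ?thesis using W(3) AB(4) unfolding Suc(2)[symmetric] by (simp add: algebra_simps)
    qed
    ultimately show ?thesis using W'(1) by blast
  qed
qed

text \<open>For \<open>d = 1\<close> the distances of close pairs only sum up to \<open>N log N\<close>, so this case needs a
  different argument: some value of some coordinate is taken by at most one member; flipping that
  coordinate of that member makes the coordinate constant.\<close>

lemma exists_thin_coordinate:
  assumes "finite F" "vc_le 1 F" "finite T" "T \<noteq> {}"
    and agree: "\<And>A B. A \<in> F \<Longrightarrow> B \<in> F \<Longrightarrow> A - T = B - T"
  obtains i b where "i \<in> T" "card {A\<in>F. (i \<in> A) = b} \<le> 1"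
proof -
  let ?c = "\<lambda>(i, b). card {A\<in>F. (i \<in> A) = b}"
  \<comment> \<open>A coordinate in \<open>T\<close> and a value of it taken by the fewest
    members.\<close>
  define p where "p = arg_min_on ?c (T \<times> (UNIV :: bool set))"
  have fin: "finite (T \<times> (UNIV :: bool set))" "T \<times> (UNIV :: bool set) \<noteq> {}"
    using assms by auto
  obtain i b where ib: "p = (i, b)" by (cases p)
  have iT: "i \<in> T"
    using arg_min_if_finite(1)[OF fin, of ?c] by (simp add: p_def[symmetric] ib)
  have min: "card {A\<in>F. (i \<in> A) = b} \<le> card {A\<in>F. (j \<in> A) = c}" if "j \<in> T" for j c
    using arg_min_least[OF fin, of "(j, c)" ?c] that by (simp add: p_def[symmetric] ib)
  have "card {A\<in>F. (i \<in> A) = b} \<le> 1"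
  proof (rule ccontr)
    assume "\<not> card {A\<in>F. (i \<in> A) = b} \<le> 1"
    \<comment> \<open>Two members have value \<open>b\<close> at \<open>i\<close> and differ at some
      \<open>j\<close>. A pattern missed on \<open>{i, j}\<close> then has the other value at
      \<open>i\<close>, so all members with its value at \<open>j\<close> have value
      \<open>b\<close> at \<open>i\<close>. They form a strictly smaller group, against
      minimality.\<close>
    then obtain A1 A2 where A: "A1 \<in> F" "A2 \<in> F" "(i \<in> A1) = b" "(i \<in> A2) = b" "A1 \<noteq> A2"
      using card_le_Suc0_iff_eq[of "{A\<in>F. (i \<in> A) = b}"] assms(1) by auto
    then obtain j where j: "(j \<in> A1) \<noteq> (j \<in> A2)" by blast
    have jT: "j \<in> T" using agree[OF A(1,2)] j by blast
    have ij: "i \<noteq> j" using A j by blast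
    have "\<not> set_shatters F {i, j}"
      using assms(2) ij unfolding vc_le_def by (metis card_2_iff finite.emptyI finite_insert
          not_less_eq_eq numeral_2_eq_2 One_nat_def order_refl)
    then obtain B where B: "B \<subseteq> {i, j}" "\<And>A. A \<in> F \<Longrightarrow> A \<inter> {i, j} \<noteq> B"
      unfolding set_shatters_def by blast
    have miss: "\<not> ((i \<in> A) = (i \<in> B) \<and> (j \<in> A) = (j \<in> B))" if "A \<in> F" for A
    proof
      assume "(i \<in> A) = (i \<in> B) \<and> (j \<in> A) = (j \<in> B)"
      then have "A \<inter> {i, j} = B" using B(1) by blast
      then show False using B(2)[OF that] by blast
    qed
    have bi: "(i \<in> B) \<noteq> b" using miss[OF A(1)] miss[OF A(2)] A(3,4) j by blast
    let ?c = "j \<in> B"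
    have "{A\<in>F. (j \<in> A) = ?c} \<subseteq> {A\<in>F. (i \<in> A) = b}" using miss bi by blast
    moreover obtain A0 where "A0 \<in> {A\<in>F. (i \<in> A) = b}" "A0 \<notin> {A\<in>F. (j \<in> A) = ?c}"
      using A j by blast
    ultimately have "{A\<in>F. (j \<in> A) = ?c} \<subset> {A\<in>F. (i \<in> A) = b}" by blast
    then have "card {A\<in>F. (j \<in> A) = ?c} < card {A\<in>F. (i \<in> A) = b}"
      using assms(1) by (intro psubset_card_mono) auto
    then show False using min[OF jT, of ?c] by simp
  qed
  then show thesis using that iT by blast
qed

text \<open>\<open>T\<close> holds the coordinates that may still vary. Each induction step makes
  one of them constant and attaches at most one vertex.\<close>

lemma vc_le_1_subset_grown_aux:
  assumes "finite S" "finite T" "T \<subseteq> S" "F \<subseteq> Pow S" "vc_le 1 F" "F \<noteq> {}"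
    and "\<And>A B. A \<in> F \<Longrightarrow> B \<in> F \<Longrightarrow> A - T = B - T"
  shows "\<exists>W\<in>grown S (card T). F \<subseteq> W"
  using assms(2-)
proof (induction "card T" arbitrary: T F)
  case 0
  then have T: "T = {}" by simp
  obtain A where A: "A \<in> F" using \<open>F \<noteq> {}\<close> by blast
  have "B = A" if "B \<in> F" for B using 0(7)[OF that A] unfolding T by (simp only: Diff_empty)
  then have "F = {A}" using A by blast
  moreover have "{A} \<in> grown S 0" using A 0(4) by auto
  ultimately show ?case unfolding T by (intro bexI[of _ "{A}"]) simp_all
next
  case (Suc n)
  note agree = Suc.prems(6)
  have fin: "finite F" using Suc.prems(3) assms(1) by (meson finite_Pow_iff finite_subset)
  have "T \<noteq> {}" using Suc(2) by auto
  from exists_thin_coordinate[OF fin Suc.prems(4,1) this agree]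
  obtain i b where i: "i \<in> T" and thin: "card {A\<in>F. (i \<in> A) = b} \<le> 1" .
  let ?T = "T - {i}"
  have n: "n = card ?T" using i Suc(2) Suc.prems(1) by simp
  have T: "finite ?T" "?T \<subseteq> S" using Suc.prems(1,2) by auto
  have agree': "A - ?T = B - ?T"
    if "A - T = B - T" "(i \<in> A) = (i \<in> B)" for A B
  proof (rule set_eqI)
    fix x
    have "x \<in> A - T \<longleftrightarrow> x \<in> B - T" using that(1) by (simp only:)
    then show "x \<in> A - ?T \<longleftrightarrow> x \<in> B - ?T"
      using that(2) by (metis Diff_iff empty_iff insert_iff)
  qed
  show ?case
  proof (cases "{A\<in>F. (i \<in> A) = b} = {}")
    \<comment> \<open>No member has value \<open>b\<close> at \<open>i\<close>, so \<open>i\<close>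
      is constant already.\<close>
    case True
    have "\<exists>W\<in>grown S (card ?T). F \<subseteq> W"
    proof (rule Suc.hyps(1)[OF n T Suc.prems(3-5)])
      fix A B assume AB: "A \<in> F" "B \<in> F"
      have "(i \<in> A) \<noteq> b" "(i \<in> B) \<noteq> b" using True AB by blast+
      then have "(i \<in> A) = (i \<in> B)" by argo
      then show "A - ?T = B - ?T" by (rule agree'[OF agree[OF AB]])
    qed
    moreover have "grown S (card ?T) \<subseteq> grown S (card T)" using n Suc(2) by (intro grown_mono) simp
    ultimately show ?thesis by (meson subsetD)
  next
    case False
    then obtain A where A: "A \<in> F" "(i \<in> A) = b" by blast
    have others: "(i \<in> B) \<noteq> b" if "B \<in> F" "B \<noteq> A" for B
    proof
      define E where "E = {A\<in>F. (i \<in> A) = b}"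
      have "finite E" unfolding E_def by (rule finite_subset[OF _ fin]) (rule Collect_restrict)
      moreover have "card E \<le> Suc 0" using thin unfolding E_def One_nat_def .
      ultimately have single: "\<forall>A\<in>E. \<forall>B\<in>E. A = B" by (rule card_le_Suc0_iff_eq[THEN iffD1])
      assume "(i \<in> B) = b"
      then have "A \<in> E" "B \<in> E" unfolding E_def using A that(1) by simp_all
      then show False using single that(2) by blast
    qed
    let ?A = "sym_diff A {i}"
    let ?G = "insert ?A (F - {A})"
    have iG: "(i \<in> B) \<noteq> b" if "B \<in> ?G" for B
    proof (cases "B = ?A")
      case True
      then show ?thesis using A(2) by (cases b) simp_all
    next
      case False
      then have "B \<in> F" "B \<noteq> A" using that by simp_all
      then show ?thesis by (rule others)
    qed
    have "\<exists>W\<in>grown S (card ?T). ?G \<subseteq> W"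
    proof (rule Suc.hyps(1)[OF n T])
      have "A \<subseteq> S" "i \<in> S" using Suc.prems(2,3) A(1) i by auto
      then show "?G \<subseteq> Pow S" using Suc.prems(3) by auto
      show "?G \<noteq> {}" by blast
      \<comment> \<open>\<open>i\<close> is constant on \<open>?G\<close>, so no shattered set
        contains it; on sets without \<open>i\<close>, the flipped set has the same trace as
        \<open>A\<close>.\<close>
      show "vc_le 1 ?G"
        unfolding vc_le_def
      proof (intro allI impI)
        fix Y assume Y: "finite Y" "set_shatters ?G Y"
        have iY: "i \<notin> Y"
        proof
          assume "i \<in> Y"
          then have "(if b then {i} else {}) \<subseteq> Y" by simp
          from set_shattersE[OF Y(2) this]
          obtain B where B: "B \<in> ?G" "B \<inter> Y = (if b then {i} else {})" .
          have "i \<in> B \<longleftrightarrow> i \<in> B \<inter> Y" using \<open>i \<in> Y\<close> by simp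
          also have "\<dots> = b" unfolding B(2) by simp
          finally show False using iG[OF B(1)] by argo
        qed
        have "set_shatters F Y"
          unfolding set_shatters_def
        proof (intro allI impI)
          fix B assume "B \<subseteq> Y"
          from set_shattersE[OF Y(2) this] obtain D where D: "D \<in> ?G" "D \<inter> Y = B" .
          show "\<exists>A\<in>F. A \<inter> Y = B"
          proof (cases "D = ?A")
            case True
            then have "A \<inter> Y = B" using D(2) iY by blast
            then show ?thesis using A(1) by blast
          next
            case False
            then show ?thesis using D by blast
          qed
        qed
        then show "card Y \<le> 1" using Suc.prems(4) Y(1) unfolding vc_le_def by blast
      qed
      fix B D assume BD: "B \<in> ?G" "D \<in> ?G"
      have out: "B - T = A - T" if "B \<in> ?G" for B
      proof (cases "B = ?A")
        case True
        then show ?thesis using i by blast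
      next
        case False
        then have "B \<in> F" using that by simp
        then show ?thesis using A(1) by (rule agree)
      qed
      have "(i \<in> B) = (i \<in> D)" using iG[OF BD(1)] iG[OF BD(2)] by argo
      then show "B - ?T = D - ?T" using out[OF BD(1)] out[OF BD(2)] by (intro agree') simp_all
    qed
    then obtain W where W: "W \<in> grown S (card ?T)" "?G \<subseteq> W" by blast
    \<comment> \<open>Flipping \<open>i\<close> back leads along one edge from \<open>?A\<close>,
      which lies in \<open>W\<close>, to \<open>A\<close>.\<close>
    have "insert (sym_diff ?A {i}) W \<in> grown S (Suc (card ?T))"
      using W i Suc.prems(2) by (intro grown_Suc_insert) auto
    moreover have "sym_diff ?A {i} = A" by blast
    moreover have "Suc (card ?T) = card T" using n Suc(2) by simp
    moreover have "F \<subseteq> insert A W" using W(2) by blast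
    ultimately show ?thesis by metis
  qed
qed

lemma vc_le_1_subset_grown:
  assumes "finite S" "F \<subseteq> Pow S" "vc_le 1 F" "F \<noteq> {}"
  shows "\<exists>W\<in>grown S (card S). F \<subseteq> W"
proof (rule vc_le_1_subset_grown_aux[OF assms(1,1) subset_refl assms(2-)])
  fix A B :: "'a set" assume "A \<in> F" "B \<in> F"
  then have "A - S = {}" "B - S = {}" using assms(2) by blast+
  then show "A - S = B - S" by (simp only:)
qed

section \<open>One step bound for all families, and their number\<close>

lemma vc_le_subset_grown_uniform:
  assumes "finite S" "S \<noteq> {}" "F \<subseteq> Pow S" "vc_le d F" "F \<noteq> {}" "0 < d"
  shows "\<exists>W\<in>grown S ((80 * card S) ^ d). F \<subseteq> W"
proof -
  define n where "n = card S"
  have n: "n \<ge> 1" using assms(1,2) by (simp add: n_def Suc_le_eq card_gt_0_iff)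
  have "\<exists>t\<le>(80 * n) ^ d. \<exists>W\<in>grown S t. F \<subseteq> W"
  proof (cases "d = 1")
    case True
    have "\<exists>W\<in>grown S (card S). F \<subseteq> W"
      using assms(4) unfolding True by (rule vc_le_1_subset_grown[OF assms(1,3) _ assms(5)])
    then show ?thesis unfolding True by (intro exI[of _ n]) (simp add: n_def)
  next
    case False
    then have d: "2 \<le> d" using assms(6) by simp
    from vc_le_subset_grown[OF assms(1,3,4,5) d]
    obtain t W where W: "W \<in> grown S t" "F \<subseteq> W"
      and t: "real t \<le> 4 * real d * card F + 32 * real d * card S * card F powr (1 - 1 / d)"
      by (elim exE bexE conjE)
    have "card F \<le> Suc n ^ d" unfolding n_def by (rule card_le_Suc_card_power[OF assms(1,3,4)])
    also have "\<dots> \<le> (2 * n) ^ d" using n by (intro power_mono) auto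
    finally have "real (card F) \<le> real ((2 * n) ^ d)" by (rule of_nat_mono)
    then have F: "real (card F) \<le> (2 * real n) ^ d" by simp
    have "card F powr (1 - 1 / d) \<le> ((2 * real n) ^ d) powr (1 - 1 / d)"
      using F d by (intro powr_mono2) auto
    also have "\<dots> = (2 * real n) powr (d * (1 - 1 / d))"
    proof -
      have "(2 * real n) ^ d = (2 * real n) powr d"
        using n by (intro powr_realpow[symmetric]) auto
      then show ?thesis by (simp only: powr_powr)
    qed
    also have "d * (1 - 1 / d) = real (d - 1)" using d by (simp add: field_simps)
    also have "(2 * real n) powr real (d - 1) = (2 * real n) ^ (d - 1)"
      using n by (intro powr_realpow) auto
    finally have P: "card F powr (1 - 1 / d) \<le> (2 * real n) ^ (d - 1)" .
    have "real t \<le> 4 * real d * (2 * real n) ^ d + 32 * real d * n * (2 * real n) ^ (d - 1)"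
      using t F P unfolding n_def
      by (elim order_trans) (intro add_mono mult_left_mono; simp)
    also have "32 * real d * n * (2 * real n) ^ (d - 1) = 16 * real d * (2 * real n) ^ d"
      using d by (cases d) auto
    also have "4 * real d * (2 * real n) ^ d + 16 * real d * (2 * real n) ^ d
        = real d * 20 * (2 * real n) ^ d" by simp
    \<comment> \<open>\<open>d \<le> 2 ^ d\<close> and \<open>20 \<le> 20 ^ d\<close> move the
      constants under the power; \<open>80\<close> is \<open>2 * 20 * 2\<close>.\<close>
    also have "\<dots> \<le> 2 ^ d * 20 ^ d * (2 * real n) ^ d"
      using assms(6) of_nat_less_two_power[of d, where ?'a = real]
      by (intro mult_right_mono mult_mono) (auto simp: self_le_power)
    also have "\<dots> = (2 * 20 * (2 * real n)) ^ d" by (simp only: power_mult_distrib)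
    also have "2 * 20 * (2 * real n) = real (80 * n)" by simp
    also have "real (80 * n) ^ d = real ((80 * n) ^ d)" by simp
    finally have "t \<le> (80 * n) ^ d" by (simp only: of_nat_le_iff)
    then show ?thesis using W by blast
  qed
  then obtain t W where "t \<le> (80 * n) ^ d" "W \<in> grown S t" "F \<subseteq> W" by blast
  moreover have "grown S t \<subseteq> grown S ((80 * n) ^ d)" by (rule grown_mono) fact
  ultimately show ?thesis unfolding n_def by blast
qed

text \<open>A family is described by a connected set from \<open>grown S T\<close> and a subset of
  it; the connected set has at most \<open>Suc T\<close> vertices.\<close>

lemma card_vc_le_families:
  assumes "finite S" "S \<noteq> {}" "0 < d"
  defines "T \<equiv> (80 * card S) ^ d"
  shows "card {F. F \<subseteq> Pow S \<and> vc_le d F} \<le> 2 ^ card S * (1 + T * card S) ^ T * 2 ^ Suc T"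
proof -
  have fin: "finite (grown S T)" using card_grown[OF assms(1)] by simp
  have finW: "finite W" "card W \<le> Suc T" if "W \<in> grown S T" for W
    using card_grown_member[OF that] by auto
  have "{F. F \<subseteq> Pow S \<and> vc_le d F} \<subseteq> (\<Union>W\<in>grown S T. Pow W)"
  proof
    fix F assume F: "F \<in> {F. F \<subseteq> Pow S \<and> vc_le d F}"
    have "\<exists>W\<in>grown S T. F \<subseteq> W"
    proof (cases "F = {}")
      \<comment> \<open>The empty family lies in every connected set; a single vertex serves as
        witness.\<close>
      case True
      have "{{}} \<in> grown S T" using grown_mono[of 0 T S] by auto
      then show ?thesis using True by blast
    next
      case False
      then show ?thesis
        using F vc_le_subset_grown_uniform[OF assms(1,2) _ _ False assms(3)] by (simp add: T_def)
    qed
    then show "F \<in> (\<Union>W\<in>grown S T. Pow W)" by blast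
  qed
  then have "card {F. F \<subseteq> Pow S \<and> vc_le d F} \<le> card (\<Union>W\<in>grown S T. Pow W)"
    using fin finW by (intro card_mono) auto
  also have "\<dots> \<le> (\<Sum>W\<in>grown S T. card (Pow W))"
    by (rule card_UN_le[OF fin])
  also have "\<dots> \<le> (\<Sum>W\<in>grown S T. 2 ^ Suc T)"
  proof (rule sum_mono)
    fix W assume "W \<in> grown S T"
    then show "card (Pow W) \<le> 2 ^ Suc T"
      using finW by (simp add: card_Pow del: power_Suc)
  qed
  also have "\<dots> = card (grown S T) * 2 ^ Suc T" by simp
  also have "\<dots> \<le> 2 ^ card S * (1 + T * card S) ^ T * 2 ^ Suc T"
    using card_grown[OF assms(1)] by (intro mult_right_mono) auto
  finally show ?thesis .
qed

section \<open>Sign vectors and the upper bound\<close>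

text \<open>Restricted to \<open>S\<close> because members of \<open>sign_cube S\<close> are
  extensional, with value \<open>undefined\<close> outside \<open>S\<close>.\<close>

definition sign_vec :: "nat set \<Rightarrow> nat set \<Rightarrow> nat \<Rightarrow> int" where
  "sign_vec S A = (\<lambda>i\<in>S. if i \<in> A then 1 else - 1)"

lemma bij_betw_sign_vec: "bij_betw (sign_vec S) (Pow S) (sign_cube S)"
proof (rule bij_betw_byWitness[where f' = "\<lambda>p. {i\<in>S. p i = 1}"])
  show "\<forall>A\<in>Pow S. {i\<in>S. sign_vec S A i = 1} = A" by (auto simp: sign_vec_def)
  show "\<forall>p\<in>sign_cube S. sign_vec S {i\<in>S. p i = 1} = p"
  proof
    fix p assume p: "p \<in> sign_cube S"
    show "sign_vec S {i\<in>S. p i = 1} = p"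
    proof
      fix i show "sign_vec S {i\<in>S. p i = 1} i = p i"
        using p by (cases "i \<in> S") (auto simp: sign_vec_def sign_cube_def PiE_iff extensional_def)
    qed
  qed
  show "sign_vec S ` Pow S \<subseteq> sign_cube S"
    by (auto simp: sign_vec_def sign_cube_def split: if_splits)
  show "(\<lambda>p. {i\<in>S. p i = 1}) ` sign_cube S \<subseteq> Pow S" by auto
qed

lemma restrict_sign_vec:
  assumes "Y \<subseteq> S"
  shows "restrict (sign_vec S A) Y = sign_vec Y (A \<inter> Y)"
  using assms by (auto simp: sign_vec_def restrict_def fun_eq_iff)

lemma shatters_sign_vec_iff:
  assumes "Y \<subseteq> S"
  shows "shatters (sign_vec S ` F) Y \<longleftrightarrow> set_shatters F Y"
proof -
  have cube: "sign_cube Y = sign_vec Y ` Pow Y" and inj: "inj_on (sign_vec Y) (Pow Y)"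
    using bij_betw_sign_vec[of Y] by (auto simp: bij_betw_def)
  have "sign_vec Y (A \<inter> Y) = sign_vec Y B \<longleftrightarrow> A \<inter> Y = B" if "B \<subseteq> Y" for A B
    using inj that by (auto simp: inj_on_eq_iff)
  then have "shatters (sign_vec S ` F) Y \<longleftrightarrow> (\<forall>B\<in>Pow Y. \<exists>A\<in>F. A \<inter> Y = B)"
    unfolding shatters_def cube by (simp add: restrict_sign_vec[OF assms])
  then show ?thesis unfolding set_shatters_def by (simp only: Ball_def Pow_iff)
qed

text \<open>\<open>sign_vec\<close> lifts to a bijection from families to classes that preserves
  shattering, so the counting can be done with families alone.\<close>

lemma num_classes_eq_card_families:
  "num_classes N d
     = card {F. F \<subseteq> Pow {1..N} \<and> Sup {card Y | Y. Y \<subseteq> {1..N} \<and> set_shatters F Y} = d}"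
    (is "_ = card ?L")
proof -
  let ?S = "{1..N}"
  let ?R = "{C. C \<subseteq> sign_cube ?S \<and> vc_dim N C = d}"
  have bij: "bij_betw ((`) (sign_vec ?S)) (Pow (Pow ?S)) (Pow (sign_cube ?S))"
    by (rule bij_betw_Pow[OF bij_betw_sign_vec])
  have vc: "vc_dim N (sign_vec ?S ` F) = Sup {card Y | Y. Y \<subseteq> ?S \<and> set_shatters F Y}" for F
    unfolding vc_dim_def by (rule arg_cong[where f = Sup]) (auto simp: shatters_sign_vec_iff)
  have img: "(`) (sign_vec ?S) ` ?L = ?R"
  proof (intro equalityI subsetI)
    fix C assume "C \<in> (`) (sign_vec ?S) ` ?L"
    then obtain F where F: "F \<in> ?L" "C = sign_vec ?S ` F" by blast
    have "C \<in> (`) (sign_vec ?S) ` Pow (Pow ?S)" using F by blast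
    then have "C \<in> Pow (sign_cube ?S)" using bij by (simp add: bij_betw_def)
    then show "C \<in> ?R" using F vc by simp
  next
    fix C assume C: "C \<in> ?R"
    then have "C \<in> (`) (sign_vec ?S) ` Pow (Pow ?S)" using bij by (simp add: bij_betw_def)
    then obtain F where "F \<subseteq> Pow ?S" "C = sign_vec ?S ` F" by blast
    then show "C \<in> (`) (sign_vec ?S) ` ?L" using C vc by auto
  qed
  have "inj_on ((`) (sign_vec ?S)) ?L"
    by (rule inj_on_subset[OF bij_betw_imp_inj_on[OF bij]]) auto
  then show ?thesis unfolding num_classes_def img[symmetric] by (rule card_image)
qed

text \<open>\<open>Sup\<close> of natural numbers is an upper bound only for bounded sets; here
  \<open>S\<close> is finite, so only finitely many sizes occur.\<close>

lemma vc_le_Sup: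
  assumes "finite S" "F \<subseteq> Pow S"
  shows "vc_le (Sup {card Y | Y. Y \<subseteq> S \<and> set_shatters F Y}) F"
  unfolding vc_le_def
proof (intro allI impI)
  fix Y assume Y: "set_shatters F Y"
  have "finite {card Y | Y. Y \<subseteq> S \<and> set_shatters F Y}"
    by (rule finite_subset[of _ "card ` Pow S"]) (use assms(1) in auto)
  then have "bdd_above {card Y | Y. Y \<subseteq> S \<and> set_shatters F Y}" by simp
  moreover have "Y \<subseteq> S" by (rule set_shatters_subset[OF assms(2) Y])
  ultimately show "card Y \<le> Sup {card Y | Y. Y \<subseteq> S \<and> set_shatters F Y}"
    using Y by (intro cSup_upper) auto
qed

lemma Sup_shattered_eq:
  assumes "finite S" "vc_le d F" "D \<subseteq> S" "set_shatters F D" "card D = d"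
  shows "Sup {card Y | Y. Y \<subseteq> S \<and> set_shatters F Y} = d"
proof (rule cSup_eq_maximum)
  show "d \<in> {card Y | Y. Y \<subseteq> S \<and> set_shatters F Y}" using assms by blast
  fix k assume "k \<in> {card Y | Y. Y \<subseteq> S \<and> set_shatters F Y}"
  then obtain Y where "k = card Y" "Y \<subseteq> S" "set_shatters F Y" by blast
  then show "k \<le> d" using assms(1,2) finite_subset unfolding vc_le_def by blast
qed

lemma num_classes_le:
  assumes "N \<ge> 80" "0 < d"
  shows "real (num_classes N d) \<le> real N powr ((1120 * real N) ^ d)"
proof -
  let ?S = "{1..N}"
  define T where "T = (80 * N) ^ d"
  have fin: "finite {F. F \<subseteq> Pow ?S \<and> vc_le d F}"
    by (rule finite_subset[of _ "Pow (Pow ?S)"]) auto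
  have "num_classes N d \<le> card {F. F \<subseteq> Pow ?S \<and> vc_le d F}"
    unfolding num_classes_eq_card_families using vc_le_Sup[of ?S] by (intro card_mono[OF fin]) auto
  also have "\<dots> \<le> 2 ^ N * (1 + T * N) ^ T * 2 ^ Suc T"
    using card_vc_le_families[of ?S d] assms by (simp add: T_def)
  \<comment> \<open>All bases become powers of \<open>N\<close>; \<open>N \<ge> 80\<close> gives
    \<open>80 * N \<le> N ^ 2\<close>, hence \<open>T \<le> N ^ (2 * d)\<close>.\<close>
  also have "\<dots> \<le> N ^ N * (N ^ (2 * d + 2)) ^ T * N ^ Suc T"
  proof (intro mult_mono power_mono)
    have "80 * N \<le> N ^ 2" using assms(1) by (simp add: power2_eq_square)
    then have "T \<le> (N ^ 2) ^ d" unfolding T_def by (rule power_mono) simp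
    then have "T \<le> N ^ (2 * d)" by (simp only: power_mult)
    then have "T * N \<le> N ^ (2 * d) * N" by (rule mult_right_mono) simp
    moreover have "1 \<le> N ^ (2 * d) * N" using assms(1) by simp
    ultimately have "1 + T * N \<le> 2 * (N ^ (2 * d) * N)" by linarith
    also have "\<dots> \<le> N * (N ^ (2 * d) * N)" using assms(1) by (intro mult_right_mono) auto
    also have "\<dots> = N ^ (2 * d + 2)" by (simp add: power_add power2_eq_square)
    finally show "1 + T * N \<le> N ^ (2 * d + 2)" .
  qed (use assms in auto)
  also have "\<dots> = N ^ (N + (2 * d + 2) * T + Suc T)"
    by (simp only: power_add power_mult)
  also have "\<dots> \<le> N ^ ((1120 * N) ^ d)"
  proof (rule power_increasing)
    \<comment> \<open>As \<open>N\<close> and \<open>1\<close> are at most \<open>T\<close>, the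
      exponent is at most \<open>(2 * d + 5) * T\<close>, hence at most \<open>7 * d * T\<close>.
      Moving \<open>7 * d\<close> under the power multiplies the base by \<open>14\<close>, and
      \<open>14 * 80 = 1120\<close>.\<close>
    have "80 * N \<le> T" unfolding T_def using assms by (intro self_le_power) auto
    then have "N \<le> T" "1 \<le> T" using assms(1) by linarith+
    then have "N + (2 * d + 2) * T + Suc T \<le> T + (2 * d + 2) * T + (T + T)" by linarith
    also have "\<dots> = (2 * d + 5) * T" by (simp add: algebra_simps)
    also have "\<dots> \<le> (d * 7) * T" using assms(2) by (intro mult_right_mono) auto
    also have "\<dots> \<le> (2 ^ d * 7 ^ d) * T"
      using assms(2) less_exp[of d] by (intro mult_right_mono mult_mono self_le_power) auto
    also have "\<dots> = (2 * 7 * (80 * N)) ^ d" unfolding T_def by (simp only: power_mult_distrib)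
    also have "2 * 7 * (80 * N) = 1120 * N" by simp
    finally show "N + (2 * d + 2) * T + Suc T \<le> (1120 * N) ^ d" .
  qed (use assms in auto)
  finally have "real (num_classes N d) \<le> real (N ^ ((1120 * N) ^ d))" by (rule of_nat_mono)
  also have "\<dots> = real N ^ ((1120 * N) ^ d)" by (rule of_nat_power)
  also have "\<dots> = real N powr real ((1120 * N) ^ d)"
    using assms(1) by (intro powr_realpow[symmetric]) auto
  finally show ?thesis by simp
qed

section \<open>Lower bound\<close>

definition apex_family :: "nat \<Rightarrow> 'a set \<Rightarrow> 'a set \<Rightarrow> ('a set \<Rightarrow> 'a) \<Rightarrow> 'a set set" where
  "apex_family d P D h = (\<lambda>X. insert (h X) X) ` {X. X \<subseteq> P \<and> card X = d} \<union> Pow D"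

text \<open>A shattered \<open>Y\<close> with more than \<open>d\<close> points lies in a member and
  so equals some \<open>insert (h X) X\<close>. A member with trace \<open>X\<close> on
  \<open>Y\<close> meets \<open>P\<close>, so it is \<open>insert (h X') X'\<close> with
  \<open>X \<subseteq> X'\<close>; equal sizes force \<open>X = X'\<close>, and its trace is all of
  \<open>Y\<close>.\<close>

lemma apex_family_vc_le:
  assumes "finite P" "finite D" "card D = d" "0 < d" "P \<inter> D = {}"
    and h: "\<And>X. X \<subseteq> P \<Longrightarrow> card X = d \<Longrightarrow> h X \<notin> P"
  shows "vc_le d (apex_family d P D h)"
  unfolding vc_le_def
proof (intro allI impI, rule ccontr)
  fix Y assume Y: "finite Y" "set_shatters (apex_family d P D h) Y" "\<not> card Y \<le> d"
  from set_shattersE[OF Y(2) subset_refl]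
  obtain A where A: "A \<in> apex_family d P D h" "A \<inter> Y = Y" .
  have "\<not> A \<subseteq> D"
  proof
    assume "A \<subseteq> D"
    then have "card Y \<le> card D" using A(2) assms(2) by (intro card_mono) auto
    then show False using Y(3) assms(3) by simp
  qed
  then obtain X where X: "X \<subseteq> P" "card X = d" "A = insert (h X) X"
    using A(1) unfolding apex_family_def by blast
  have "finite X" using X(1) assms(1) by (rule finite_subset)
  then have cA: "finite A" "card A = Suc d" using X h[OF X(1,2)] by (auto simp: card_insert_if)
  have YA: "Y = A"
    by (rule card_seteq) (use A(2) Y(3) cA in auto)
  have "X \<subseteq> Y" using X YA by blast
  from set_shattersE[OF Y(2) this]
  obtain A' where A': "A' \<in> apex_family d P D h" "A' \<inter> Y = X" .
  have XA': "X \<subseteq> A'" using A'(2) by blast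
  have "X \<noteq> {}" using X(2) assms(4) by auto
  then have "\<not> A' \<subseteq> D" using XA' X(1) assms(5) by blast
  then obtain X' where X': "X' \<subseteq> P" "card X' = d" "A' = insert (h X') X'"
    using A'(1) unfolding apex_family_def by blast
  have "X \<subseteq> X'" using XA' X(1) h[OF X'(1,2)] X'(3) by blast
  then have "X = X'"
    using X(2) X'(1,2) assms(1) by (intro card_seteq) (auto intro: finite_subset)
  then have "A' = A" using X X' by simp
  then have "A = X" using A'(2) YA by simp
  then show False using X(2) cA by simp
qed

lemma apex_family_shatters: "set_shatters (apex_family d P D h) D"
  unfolding set_shatters_def
proof (intro allI impI)
  fix B assume "B \<subseteq> D"
  then have "B \<in> apex_family d P D h" "B \<inter> D = B" by (auto simp: apex_family_def)
  then show "\<exists>A\<in>apex_family d P D h. A \<inter> D = B" by blast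
qed

text \<open>Intersecting \<open>insert (h X) X\<close> with \<open>P\<close> recovers
  \<open>X\<close>, and the remaining point is \<open>h X\<close>. Subsets of \<open>D\<close>
  cannot interfere, since \<open>d > 0\<close> makes \<open>X\<close> a nonempty subset of
  \<open>P\<close>.\<close>

lemma apex_family_inj:
  assumes "0 < d" "P \<inter> Q = {}" "D \<subseteq> Q"
  shows "inj_on (apex_family d P D) ({X. X \<subseteq> P \<and> card X = d} \<rightarrow>\<^sub>E Q)"
proof (rule inj_onI)
  fix g h assume g: "g \<in> {X. X \<subseteq> P \<and> card X = d} \<rightarrow>\<^sub>E Q"
    and h: "h \<in> {X. X \<subseteq> P \<and> card X = d} \<rightarrow>\<^sub>E Q"
    and eq: "apex_family d P D g = apex_family d P D h"
  show "g = h"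
  proof (rule PiE_ext[OF g h])
    fix X assume X: "X \<in> {X. X \<subseteq> P \<and> card X = d}"
    have "insert (g X) X \<in> apex_family d P D g"
      unfolding apex_family_def using X by (intro UnI1 imageI)
    then have "insert (g X) X \<in> apex_family d P D h" unfolding eq .
    moreover have "X \<noteq> {}" using X assms(1) by auto
    then have "\<not> insert (g X) X \<subseteq> D" using X assms(2,3) by blast
    ultimately obtain X' where X': "X' \<in> {X. X \<subseteq> P \<and> card X = d}"
      "insert (g X) X = insert (h X') X'"
      unfolding apex_family_def by blast
    have q: "g X \<in> Q" "h X' \<in> Q" using g h X X' by (auto dest: PiE_mem)
    have "insert (g X) X \<inter> P = X" "insert (h X') X' \<inter> P = X'"
      using q X X'(1) assms(2) by auto
    then have XX: "X = X'" using X'(2) by simp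
    have "g X \<notin> X" using q X assms(2) by blast
    then show "g X = h X" using X'(2) XX by blast
  qed
qed

text \<open>There are \<open>card Q ^ (p choose d)\<close> functions \<open>h\<close>, each with its
  own family of dimension exactly \<open>d\<close>.\<close>

lemma num_classes_ge:
  assumes "0 < d" "4 * d \<le> N"
  shows "real N powr ((1 / 8 * (real N / real d)) ^ d) \<le> real (num_classes N d)"
proof -
  define p where "p = N div 2"
  define P where "P = {1..p}"
  define Q where "Q = {p + 1..N}"
  define D where "D = {p + 1..p + d}"
  let ?X = "{X. X \<subseteq> P \<and> card X = d}"
  \<comment> \<open>\<open>N \<le> 4 * p\<close> allows for the rounding in \<open>N div 2\<close>;
    \<open>d \<le> p\<close> lets \<open>D\<close> fit into \<open>Q\<close>.\<close>
  have p: "N \<le> 4 * p" "2 * p \<le> N" "d \<le> p" using assms unfolding p_def by linarith+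
  have PQ: "finite P" "finite D" "card D = d" "P \<inter> Q = {}" "D \<subseteq> Q" "P \<subseteq> {1..N}" "Q \<subseteq> {1..N}"
    using p by (auto simp: P_def Q_def D_def)
  have finX: "finite ?X" by (rule finite_subset[of _ "Pow P"]) (use PQ in auto)
  have "apex_family d P D ` (?X \<rightarrow>\<^sub>E Q) \<subseteq>
      {F. F \<subseteq> Pow {1..N} \<and> Sup {card Y | Y. Y \<subseteq> {1..N} \<and> set_shatters F Y} = d}"
  proof (intro subsetI, elim imageE)
    fix F h assume F: "F = apex_family d P D h" and h: "h \<in> ?X \<rightarrow>\<^sub>E Q"
    have hQ: "h X \<in> Q" if "X \<subseteq> P" "card X = d" for X
      using h that by (auto dest: PiE_mem)
    have "F \<subseteq> Pow {1..N}"
    proof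
      fix A assume "A \<in> F"
      then consider X where "X \<subseteq> P" "card X = d" "A = insert (h X) X" | "A \<subseteq> D"
        unfolding F apex_family_def by blast
      then show "A \<in> Pow {1..N}"
        by cases (use hQ PQ(5-7) in blast)+
    qed
    moreover have "Sup {card Y | Y. Y \<subseteq> {1..N} \<and> set_shatters F Y} = d"
    proof (rule Sup_shattered_eq)
      show "vc_le d F"
        unfolding F by (rule apex_family_vc_le[OF PQ(1-3) assms(1)]) (use PQ(4,5) hQ in blast)+
      show "set_shatters F D" unfolding F by (rule apex_family_shatters)
    qed (use PQ in auto)
    ultimately show "F \<in> {F. F \<subseteq> Pow {1..N} \<and>
        Sup {card Y | Y. Y \<subseteq> {1..N} \<and> set_shatters F Y} = d}" by simp
  qed
  moreover have "finite {F. F \<subseteq> Pow {1..N} \<and>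
      Sup {card Y | Y. Y \<subseteq> {1..N} \<and> set_shatters F Y} = d}"
    by (rule finite_subset[of _ "Pow (Pow {1..N})"]) auto
  ultimately have "card (apex_family d P D ` (?X \<rightarrow>\<^sub>E Q)) \<le> num_classes N d"
    unfolding num_classes_eq_card_families by (rule card_mono[rotated])
  moreover have "card (apex_family d P D ` (?X \<rightarrow>\<^sub>E Q)) = card (?X \<rightarrow>\<^sub>E Q)"
    by (rule card_image[OF apex_family_inj[OF assms(1) PQ(4,5)]])
  moreover have "card (?X \<rightarrow>\<^sub>E Q) = card Q ^ card ?X" by (rule card_funcsetE[OF finX])
  moreover have "card ?X = p choose d" using n_subsets[OF PQ(1)] by (simp add: P_def)
  ultimately have "card Q ^ (p choose d) \<le> num_classes N d" by simp
  then have "real (card Q ^ (p choose d)) \<le> real (num_classes N d)" by (rule of_nat_mono)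
  then have count: "real (card Q) ^ (p choose d) \<le> real (num_classes N d)" by simp
  have N4: "4 \<le> N" using assms by linarith
  \<comment> \<open>\<open>card Q\<close> is at least \<open>N / 2\<close>, which is at least the
    square root of \<open>N\<close> because \<open>N \<ge> 4\<close>.\<close>
  have "real N powr (1 / 2) \<le> card Q"
  proof -
    have "N \<le> 2 * card Q" using p by (simp add: Q_def)
    then have "real N \<le> 2 * real (card Q)" by linarith
    then have "real N * real N \<le> (2 * real (card Q)) * (2 * real (card Q))"
      by (intro mult_mono) auto
    moreover have "4 * real N \<le> real N * real N" using N4 by (intro mult_right_mono) auto
    ultimately have "real N \<le> (real (card Q)) ^ 2" by (simp add: power2_eq_square)
    then have "sqrt N \<le> card Q" by (intro real_le_lsqrt) auto
    then show ?thesis by (simp add: powr_half_sqrt)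
  qed
  then have "(real N powr (1 / 2)) ^ (p choose d) \<le> real (card Q) ^ (p choose d)"
    by (intro power_mono) auto
  moreover have "real N powr ((1 / 8 * (real N / real d)) ^ d) \<le> (real N powr (1 / 2)) ^ (p choose d)"
  proof -
    \<comment> \<open>The constant \<open>1 / 8\<close> combines \<open>p \<ge> N / 4\<close> with a
      factor \<open>1 / 2\<close>, whose power is at most the exponent \<open>1 / 2\<close> of the
      square root.\<close>
    have "(1 / 8 * (real N / real d)) ^ d \<le> (1 / 2 * (real p / real d)) ^ d"
      using p(1) assms(1) by (intro power_mono) (auto simp: field_simps)
    also have "\<dots> = (1 / 2) ^ d * (real p / real d) ^ d" by (rule power_mult_distrib)
    also have "\<dots> \<le> (1 / 2) ^ 1 * real (p choose d)"
      using assms(1) binomial_ge_n_over_k_pow_k[OF p(3), where ?'a = real]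
      by (intro mult_mono power_decreasing) auto
    finally have "real N powr ((1 / 8 * (real N / real d)) ^ d) \<le> real N powr (1 / 2 * real (p choose d))"
      using N4 by (intro powr_mono) auto
    also have "\<dots> = (real N powr (1 / 2)) powr real (p choose d)" by (simp only: powr_powr)
    also have "\<dots> = (real N powr (1 / 2)) ^ (p choose d)"
      using N4 by (intro powr_realpow) auto
    finally show ?thesis .
  qed
  ultimately show ?thesis using count by linarith
qed

text \<open>\<open>a\<close> and \<open>b\<close> are quantified before \<open>d\<close>: the
  constants of the asymptotic notation are absolute. Above \<open>4 * d + 80\<close> both bounds
  apply.\<close>

theorem theorem13:
  "\<exists>a b :: real. a > 0 \<and> b > 0 \<and>
     (\<forall>d::nat. d > 0 \<longrightarrow>
       (\<exists>N0::nat. \<forall>N::nat. N > N0 \<longrightarrow>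
          real N powr ((a * (real N / real d)) ^ d) \<le> real (num_classes N d) \<and>
          real (num_classes N d) \<le> real N powr ((b * real N) ^ d)))"
proof (rule exI[of _ "1 / 8"], rule exI[of _ 1120], intro conjI allI impI)
  fix d :: nat assume d: "d > 0"
  show "\<exists>N0. \<forall>N>N0. real N powr ((1 / 8 * (real N / real d)) ^ d) \<le> real (num_classes N d) \<and>
      real (num_classes N d) \<le> real N powr ((1120 * real N) ^ d)"
    using num_classes_ge[OF d] num_classes_le[OF _ d] by (intro exI[of _ "4 * d + 80"]) auto
qed auto

end
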